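(* Let $\alpha>1$, and let $\psi$ and $\phi$ be compactly supported distributions on $\mathbb{R}$ with $\widehat\psi(0)\ne0$ and $\widehat\phi(0)\neq 0$. Let $(P_m)_{m\ge0}$ and $(Q_m)_{m\ge0}$ be the Appell sequences of polynomials generated by $$\frac{e^{xz}}{\widehat\psi(iz)}=\sum_{m=0}^\infty P_m(x)\frac{z^m}{m!},\qquad \frac{e^{xz}}{\widehat\phi(iz)}=\sum_{m=0}^\infty Q_m(x)\frac{z^m}{m!}$$ for $z$ in a neighborhood of $0$. Then $\phi$ is an $\alpha$-scaling compactly supported function with mask $\psi$ if and only if $$\sum_{k=0}^m \alpha^{-m}\binom{m}{k}P_k(\alpha x)\,Q_{m-k}(\alpha x)=Q_m(2x)$$ for all $m=0,1,2,\dots$ and all $x$.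
   Context: For a compactly supported distribution $\phi$ on $\mathbb{R}$ (with compactly supported integrable functions and measures as special cases), $\widehat\phi(\omega)=\langle\phi,e^{-i\omega(\cdot)}\rangle$ is the Fourier transform, extended to an entire function, so $\widehat\phi(iz)=\langle\phi,e^{(\cdot)z}\rangle$ for $z\in\mathbb{C}$. An Appell sequence is a sequence of polynomials $P_m$ of degree $m$ with $P_m'=mP_{m-1}$. One says that $\phi$ is $\alpha$-scaling with mask $\psi$ if it satisfies the refinement equation $\phi(x)=\int_{\mathbb{R}}\alpha\,\phi(\alpha x-y)\,d\psi(y)$ (in the sense of distributions), equivalently $\widehat\phi(u)=\widehat\psi(u/\alpha)\,\widehat\phi(u/\alpha)$ for all $u\in\mathbb{R}$. *)

theory Defs
  imports "HOL-Analysis.Analysis" "HOL-Computational_Algebra.Polynomial"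
begin

definition iter_deriv :: "nat \<Rightarrow> (real \<Rightarrow> complex) \<Rightarrow> real \<Rightarrow> complex" where
  "iter_deriv n f = ((\<lambda>g x. vector_derivative g (at x)) ^^ n) f"

definition smooth_fun :: "(real \<Rightarrow> complex) \<Rightarrow> bool" where
  "smooth_fun f \<longleftrightarrow> (\<forall>n x. iter_deriv n f differentiable at x)"

definition fun_supp :: "(real \<Rightarrow> complex) \<Rightarrow> real set" where
  "fun_supp f = closure {x. f x \<noteq> 0}"

definition test_fun :: "(real \<Rightarrow> complex) \<Rightarrow> bool" where
  "test_fun f \<longleftrightarrow> smooth_fun f \<and> compact (fun_supp f)"

text \<open>A distribution is represented by a functional on all functions, of which only the
  restriction to test functions is relevant.  Continuity is stated by the usual
  seminorm estimates on each space of test functions supported in a fixed compact set.\<close>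

definition distribution :: "((real \<Rightarrow> complex) \<Rightarrow> complex) \<Rightarrow> bool" where
  "distribution T \<longleftrightarrow>
     (\<forall>f g. test_fun f \<longrightarrow> test_fun g \<longrightarrow> T (\<lambda>x. f x + g x) = T f + T g) \<and>
     (\<forall>c f. test_fun f \<longrightarrow> T (\<lambda>x. c * f x) = c * T f) \<and>
     (\<forall>K. compact K \<longrightarrow>
        (\<exists>C N. \<forall>f. test_fun f \<longrightarrow> fun_supp f \<subseteq> K \<longrightarrow>
           norm (T f) \<le> C * (\<Sum>k\<le>N. SUP x. norm (iter_deriv k f x))))"

definition vanishes_off :: "((real \<Rightarrow> complex) \<Rightarrow> complex) \<Rightarrow> real set \<Rightarrow> bool" where
  "vanishes_off T K \<longleftrightarrow> (\<forall>f. test_fun f \<longrightarrow> fun_supp f \<inter> K = {} \<longrightarrow> T f = 0)"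

definition compactly_supported_distribution ::
    "((real \<Rightarrow> complex) \<Rightarrow> complex) \<Rightarrow> bool" where
  "compactly_supported_distribution T \<longleftrightarrow>
     distribution T \<and> (\<exists>K. compact K \<and> vanishes_off T K)"

definition cutoff_for :: "((real \<Rightarrow> complex) \<Rightarrow> complex) \<Rightarrow> (real \<Rightarrow> complex) \<Rightarrow> bool" where
  "cutoff_for T \<eta> \<longleftrightarrow> test_fun \<eta> \<and>
     (\<exists>K U. compact K \<and> vanishes_off T K \<and> open U \<and> K \<subseteq> U \<and> (\<forall>x\<in>U. \<eta> x = 1))"

text \<open>The extension of a compactly supported distribution to arbitrary smooth functions;
  the value does not depend on the choice of the cutoff function.\<close>

definition pairing :: "((real \<Rightarrow> complex) \<Rightarrow> complex) \<Rightarrow> (real \<Rightarrow> complex) \<Rightarrow> complex" where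
  "pairing T f = T (\<lambda>x. (SOME \<eta>. cutoff_for T \<eta>) x * f x)"

definition fourier :: "((real \<Rightarrow> complex) \<Rightarrow> complex) \<Rightarrow> complex \<Rightarrow> complex" where
  "fourier T \<omega> = pairing T (\<lambda>x. exp (- \<i> * \<omega> * of_real x))"

text \<open>The distribution \<open>\<alpha> \<phi>(\<alpha> x - y)\<close> in the variable \<open>x\<close>, for \<open>\<alpha> > 0\<close>: substituting
  \<open>u = \<alpha> x - y\<close> in the integral of \<open>\<alpha> \<phi>(\<alpha> x - y) f(x)\<close> gives \<open>\<phi>(u) f((u + y) / \<alpha>)\<close>.\<close>

definition dilate_shift ::
    "real \<Rightarrow> real \<Rightarrow> ((real \<Rightarrow> complex) \<Rightarrow> complex) \<Rightarrow> (real \<Rightarrow> complex) \<Rightarrow> complex" where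
  "dilate_shift \<alpha> y \<phi> f = \<phi> (\<lambda>u. f ((u + y) / \<alpha>))"

text \<open>The refinement equation tested against \<open>f\<close>; the integral with respect to \<open>\<psi>\<close> is the
  application of \<open>\<psi>\<close> to a function of \<open>y\<close>, which is itself a test function when \<open>\<phi>\<close> is
  compactly supported.\<close>

definition scaling_with_mask ::
    "real \<Rightarrow> ((real \<Rightarrow> complex) \<Rightarrow> complex) \<Rightarrow> ((real \<Rightarrow> complex) \<Rightarrow> complex) \<Rightarrow> bool" where
  "scaling_with_mask \<alpha> \<phi> \<psi> \<longleftrightarrow>
     (\<forall>f. test_fun f \<longrightarrow> \<phi> f = \<psi> (\<lambda>y. dilate_shift \<alpha> y \<phi> f))"

text \<open>The condition \<open>P m \<noteq> 0\<close> is only needed for \<open>m = 0\<close>, as the zero polynomial has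
  degree \<open>0\<close> here; for \<open>m = 0\<close> the derivative equation just says that \<open>P 0\<close> is constant.\<close>

definition appell_sequence :: "(nat \<Rightarrow> complex poly) \<Rightarrow> bool" where
  "appell_sequence P \<longleftrightarrow>
     (\<forall>m. P m \<noteq> 0 \<and> degree (P m) = m \<and> pderiv (P m) = smult (of_nat m) (P (m - 1)))"

definition generated_by :: "(nat \<Rightarrow> complex poly) \<Rightarrow> ((real \<Rightarrow> complex) \<Rightarrow> complex) \<Rightarrow> bool" where
  "generated_by P T \<longleftrightarrow>
     (\<forall>x::real. \<forall>\<^sub>F z in nhds (0::complex).
        (\<lambda>m. poly (P m) (of_real x) * z ^ m / fact m) sums
          (exp (of_real x * z) / fourier T (\<i> * z)))"

end

theory Submission
  imports Defs
begin

text \<open>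
  Everything is reduced to moments. The moments of a compactly supported distribution \<open>T\<close> are
  the values of its extension to smooth functions at the monomials \<open>x \<mapsto> x ^ m\<close>. Two facts
  make them a faithful description of \<open>T\<close>.

  First, \<open>T\<close> has finite order: on smooth functions it is bounded by finitely many derivatives on
  a bounded interval (\<open>pairing_bound\<close>). A smooth function can be approximated there by polynomials
  together with those derivatives (\<open>smooth_polynomial_approximation\<close>), so that two compactly
  supported distributions with the same moments coincide (\<open>moments_determine_distribution\<close>).
  Second, by the same bound the exponential series may be paired with \<open>T\<close> term by term, so that the
  exponential generating function of the moments, the formal power series \<open>moment_fps T\<close>, is the
  expansion of \<open>z \<mapsto> fourier T (\<i> * z)\<close> at \<open>0\<close> (\<open>fourier_has_fps_expansion\<close>).

  The right hand side of the refinement equation is the convolution of \<open>\<phi>\<close> and \<open>\<psi>\<close>, rescaled by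
  \<open>1 / \<alpha>\<close>. It is again a compactly supported distribution, and by the binomial theorem
  convolution multiplies the generating functions of the moments, while rescaling substitutes
  \<open>z / \<alpha>\<close> for \<open>z\<close>. Hence, with \<open>\<Psi>\<close> and \<open>\<Phi>\<close> for the generating functions of \<open>\<psi>\<close> and \<open>\<phi>\<close>, the
  refinement equation is equivalent to the identity \<open>\<Phi>(z) = \<Psi>(z / \<alpha>) \<Phi>(z / \<alpha>)\<close> of formal power
  series (\<open>scaling_with_mask_iff_moment_fps\<close>).

  The generating functions of the polynomials are \<open>exp (x z) / \<Psi>(z)\<close> and \<open>exp (x z) / \<Phi>(z)\<close>. The
  left hand side of the asserted identity is, up to the factor \<open>m!\<close>, the coefficient of \<open>z ^ m\<close> in
  their product at \<open>\<alpha> x\<close> with \<open>z / \<alpha>\<close> for \<open>z\<close>, which is \<open>exp (2 x z) / (\<Psi>(z / \<alpha>) \<Phi>(z / \<alpha>))\<close>; the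
  right hand side comes from \<open>exp (2 x z) / \<Phi>(z)\<close>. Cancelling the invertible series \<open>exp (2 x z)\<close>
  leaves exactly the identity of power series above.
\<close>

section \<open>Calculus of iterated derivatives\<close>

lemma iter_deriv_0 [simp]: "iter_deriv 0 f = f"
  by (simp add: iter_deriv_def)

lemma iter_deriv_Suc: "iter_deriv (Suc n) f = (\<lambda>x. vector_derivative (iter_deriv n f) (at x))"
  by (simp add: iter_deriv_def)

lemma iter_deriv_iter_deriv: "iter_deriv m (iter_deriv n f) = iter_deriv (m + n) f"
  by (simp add: iter_deriv_def funpow_add)

lemma smooth_fun_has_vector_derivative:
  assumes "smooth_fun f"
  shows "(iter_deriv n f has_vector_derivative iter_deriv (Suc n) f x) (at x)"
  using assms unfolding smooth_fun_def iter_deriv_Suc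
  by (metis vector_derivative_works)

text \<open>Closed forms of iterated derivatives are obtained below by guessing the whole sequence of
  derivatives and checking one differentiation step.\<close>

lemma iter_deriv_sequence:
  assumes "F 0 = f" and "\<And>n x. (F n has_vector_derivative F (Suc n) x) (at x)"
  shows "smooth_fun f" and "iter_deriv n f = F n"
proof -
  have *: "iter_deriv n f = F n" for n
  proof (induction n)
    case (Suc n)
    show ?case
      unfolding iter_deriv_Suc Suc.IH using assms(2) vector_derivative_at by blast
  qed (simp add: assms)
  show "iter_deriv n f = F n" by (rule *)
  show "smooth_fun f"
    unfolding smooth_fun_def * using assms(2) has_vector_derivative_def differentiable_def by blast
qed

text \<open>When no closed form of the derivatives is at hand, it suffices to exhibit a class of functions
  that is closed under differentiation.\<close>

lemma smooth_fun_coinduct: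
  assumes "f \<in> X"
    and closed: "\<And>g. g \<in> X \<Longrightarrow> \<exists>g'\<in>X. \<forall>x. (g has_vector_derivative g' x) (at x)"
  shows "smooth_fun f"
proof -
  have "iter_deriv n f \<in> X" for n
  proof (induction n)
    case (Suc n)
    from closed[OF this] obtain g' where "g' \<in> X"
      and "\<And>x. (iter_deriv n f has_vector_derivative g' x) (at x)" by blast
    moreover from this have "iter_deriv (Suc n) f = g'"
      unfolding iter_deriv_Suc by (auto intro!: vector_derivative_at)
    ultimately show ?case by simp
  qed (simp add: assms)
  then show ?thesis
    unfolding smooth_fun_def using closed has_vector_derivative_def differentiable_def by metis
qed

lemma iter_deriv_plus:
  assumes "smooth_fun f" "smooth_fun g"
  shows "smooth_fun (\<lambda>x. f x + g x)"
    and "iter_deriv n (\<lambda>x. f x + g x) = (\<lambda>x. iter_deriv n f x + iter_deriv n g x)"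
  using iter_deriv_sequence[of "\<lambda>n x. iter_deriv n f x + iter_deriv n g x" "\<lambda>x. f x + g x"] assms
  by (auto intro!: derivative_intros smooth_fun_has_vector_derivative)

lemma iter_deriv_scale:
  assumes "smooth_fun f"
  shows "smooth_fun (\<lambda>x. c * f x)"
    and "iter_deriv n (\<lambda>x. c * f x) = (\<lambda>x. c * iter_deriv n f x)"
  using iter_deriv_sequence[of "\<lambda>n x. c * iter_deriv n f x" "\<lambda>x. c * f x"] assms
  by (auto intro!: has_vector_derivative_mult_right smooth_fun_has_vector_derivative)

lemma iter_deriv_minus:
  assumes "smooth_fun f" "smooth_fun g"
  shows "smooth_fun (\<lambda>x. f x - g x)"
    and "iter_deriv n (\<lambda>x. f x - g x) = (\<lambda>x. iter_deriv n f x - iter_deriv n g x)"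
  using iter_deriv_sequence[of "\<lambda>n x. iter_deriv n f x - iter_deriv n g x" "\<lambda>x. f x - g x"] assms
  by (auto intro!: derivative_intros smooth_fun_has_vector_derivative)

lemma smooth_fun_iter_deriv: "smooth_fun f \<Longrightarrow> smooth_fun (iter_deriv n f)"
  by (simp add: smooth_fun_def iter_deriv_iter_deriv)

lemma iter_deriv_affine:
  assumes "smooth_fun f"
  shows "smooth_fun (\<lambda>x. f (a * x + b))"
    and "iter_deriv n (\<lambda>x. f (a * x + b)) = (\<lambda>x. of_real (a ^ n) * iter_deriv n f (a * x + b))"
proof -
  have "((\<lambda>x. of_real (a ^ n) * iter_deriv n f (a * x + b)) has_vector_derivative
      of_real (a ^ Suc n) * iter_deriv (Suc n) f (a * x + b)) (at x)" for n x
  proof -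
    have "((iter_deriv n f \<circ> (\<lambda>x. a * x + b)) has_vector_derivative
        a *\<^sub>R iter_deriv (Suc n) f (a * x + b)) (at x)"
      by (rule vector_diff_chain_at)
        (auto intro!: derivative_eq_intros smooth_fun_has_vector_derivative assms
          simp flip: has_real_derivative_iff_has_vector_derivative)
    then have "((\<lambda>x. of_real (a ^ n) * iter_deriv n f (a * x + b)) has_vector_derivative
      of_real (a ^ n) * (a *\<^sub>R iter_deriv (Suc n) f (a * x + b))) (at x)"
      unfolding o_def by (rule has_vector_derivative_mult_right)
    then show ?thesis by (simp add: scaleR_conv_of_real mult_ac)
  qed
  from iter_deriv_sequence[of "\<lambda>n x. of_real (a ^ n) * iter_deriv n f (a * x + b)"
      "\<lambda>x. f (a * x + b)", OF _ this]
  show "smooth_fun (\<lambda>x. f (a * x + b))"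
    and "iter_deriv n (\<lambda>x. f (a * x + b)) = (\<lambda>x. of_real (a ^ n) * iter_deriv n f (a * x + b))"
    by auto
qed

lemma iter_deriv_mult:
  assumes f: "smooth_fun f" and g: "smooth_fun g"
  shows "smooth_fun (\<lambda>x. f x * g x)"
    and "iter_deriv n (\<lambda>x. f x * g x) =
      (\<lambda>x. \<Sum>k\<le>n. of_nat (n choose k) * (iter_deriv k f x * iter_deriv (n - k) g x))"
proof -
  define F where "F = (\<lambda>n x. \<Sum>k\<le>n. of_nat (n choose k) * (iter_deriv k f x * iter_deriv (n - k) g x))"
  have "(F n has_vector_derivative F (Suc n) x) (at x)" for n x
  proof -
    let ?t = "\<lambda>i j. iter_deriv i f x * iter_deriv j g x"
    have "(F n has_vector_derivative
        (\<Sum>k\<le>n. of_nat (n choose k) * (?t k (Suc (n - k)) + ?t (Suc k) (n - k)))) (at x)"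
      unfolding F_def
      by (intro has_vector_derivative_sum has_vector_derivative_mult_right has_vector_derivative_mult
          smooth_fun_has_vector_derivative f g)
    also have "(\<Sum>k\<le>n. of_nat (n choose k) * (?t k (Suc (n - k)) + ?t (Suc k) (n - k))) =
      (\<Sum>k\<le>n. of_nat (n choose k) * ?t k (Suc n - k)) + (\<Sum>k\<le>n. of_nat (n choose k) * ?t (Suc k) (n - k))"
      by (simp add: distrib_left sum.distrib Suc_diff_le)
    also have "(\<Sum>k\<le>n. of_nat (n choose k) * ?t k (Suc n - k)) =
        (\<Sum>k\<le>Suc n. of_nat (n choose k) * ?t k (Suc n - k))"
      by simp
    also have "\<dots> = ?t 0 (Suc n) + (\<Sum>k\<le>n. of_nat (n choose Suc k) * ?t (Suc k) (n - k))"
      by (subst sum.atMost_Suc_shift) simp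
    also have "\<dots> + (\<Sum>k\<le>n. of_nat (n choose k) * ?t (Suc k) (n - k)) = F (Suc n) x"
      unfolding F_def
      by (subst sum.atMost_Suc_shift) (simp add: sum.distrib distrib_right add_ac)
    finally show ?thesis .
  qed
  moreover have "F 0 = (\<lambda>x. f x * g x)" by (simp add: F_def)
  ultimately show "smooth_fun (\<lambda>x. f x * g x)" and "iter_deriv n (\<lambda>x. f x * g x) =
      (\<lambda>x. \<Sum>k\<le>n. of_nat (n choose k) * (iter_deriv k f x * iter_deriv (n - k) g x))"
    using iter_deriv_sequence[of F "\<lambda>x. f x * g x"] by (auto simp: F_def)
qed

text \<open>By the Leibniz rule: the binomial coefficients sum to \<open>2 ^ n\<close>.\<close>

lemma norm_iter_deriv_mult_le:
  assumes "smooth_fun f" "smooth_fun g"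
    and "\<And>k. k \<le> n \<Longrightarrow> norm (iter_deriv k f x) \<le> A"
    and "\<And>k. k \<le> n \<Longrightarrow> norm (iter_deriv k g x) \<le> B"
  shows "norm (iter_deriv n (\<lambda>x. f x * g x) x) \<le> 2 ^ n * A * B"
proof -
  have "A \<ge> 0" using order_trans[OF norm_ge_zero assms(3)[of 0]] by simp
  have "norm (iter_deriv n (\<lambda>x. f x * g x) x) \<le>
      (\<Sum>k\<le>n. norm (of_nat (n choose k) * (iter_deriv k f x * iter_deriv (n - k) g x)))"
    unfolding iter_deriv_mult(2)[OF assms(1,2)] by (rule norm_sum)
  also have "\<dots> \<le> (\<Sum>k\<le>n. of_nat (n choose k) * (A * B))"
    using \<open>A \<ge> 0\<close> by (intro sum_mono) (auto simp: norm_mult intro!: mult_mono assms mult_nonneg_nonneg)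
  also have "\<dots> = 2 ^ n * A * B"
    by (simp flip: sum_distrib_right of_nat_sum add: choose_row_sum)
  finally show ?thesis .
qed

lemma iter_deriv_poly:
  fixes p :: "complex poly"
  shows "smooth_fun (\<lambda>x. poly p (of_real x))"
    and "iter_deriv n (\<lambda>x. poly p (of_real x)) = (\<lambda>x. poly ((pderiv ^^ n) p) (of_real x))"
proof -
  have "((\<lambda>x. poly ((pderiv ^^ n) p) (of_real x)) has_vector_derivative
      poly ((pderiv ^^ Suc n) p) (of_real x)) (at x)" for n x
    using has_vector_derivative_real_field[OF poly_DERIV] by simp
  from iter_deriv_sequence[of "\<lambda>n x. poly ((pderiv ^^ n) p) (of_real x)"
      "\<lambda>x. poly p (of_real x)", OF _ this]
  show "smooth_fun (\<lambda>x. poly p (of_real x))"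
    and "iter_deriv n (\<lambda>x. poly p (of_real x)) = (\<lambda>x. poly ((pderiv ^^ n) p) (of_real x))"
    by auto
qed

lemma smooth_fun_power: "smooth_fun (\<lambda>x. of_real x ^ m)"
  using iter_deriv_poly(1)[of "monom 1 m"] by (simp add: poly_monom)

lemma smooth_fun_const: "smooth_fun (\<lambda>x. c)"
  using iter_deriv_poly(1)[of "[:c:]"] by simp

lemma iter_deriv_exp:
  shows "smooth_fun (\<lambda>x. exp (z * of_real x))"
    and "iter_deriv n (\<lambda>x. exp (z * of_real x)) = (\<lambda>x. z ^ n * exp (z * of_real x))"
proof -
  have "((\<lambda>x. z ^ n * exp (z * of_real x)) has_vector_derivative
      z ^ Suc n * exp (z * of_real x)) (at x)" for n x
    by (rule has_vector_derivative_real_field[where f="\<lambda>x. z ^ n * exp (z * x)"])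
      (auto intro!: derivative_eq_intros)
  from iter_deriv_sequence[of "\<lambda>n x. z ^ n * exp (z * of_real x)"
      "\<lambda>x. exp (z * of_real x)", OF _ this]
  show "smooth_fun (\<lambda>x. exp (z * of_real x))"
    and "iter_deriv n (\<lambda>x. exp (z * of_real x)) = (\<lambda>x. z ^ n * exp (z * of_real x))"
    by auto
qed

lemma iter_deriv_cong_open:
  assumes "open U" and "\<And>x. x \<in> U \<Longrightarrow> f x = g x" and "x \<in> U"
  shows "iter_deriv n f x = iter_deriv n g x"
  using assms(3)
proof (induction n arbitrary: x)
  case (Suc n)
  show ?case
    unfolding iter_deriv_Suc
    by (rule vector_derivative_cong_eq)
      (use Suc assms(1) in \<open>auto intro: eventually_mono[OF eventually_nhds_in_open]\<close>)
qed (simp add: assms)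

lemma smooth_fun_sum:
  assumes "\<And>i. i \<in> I \<Longrightarrow> smooth_fun (f i)"
  shows "smooth_fun (\<lambda>x. \<Sum>i\<in>I. f i x)"
  using assms
  by (induction I rule: infinite_finite_induct) (auto intro: smooth_fun_const iter_deriv_plus)

section \<open>Smooth cutoffs and polynomial approximation\<close>

lemma smooth_fun_mean_value:
  assumes f: "smooth_fun f" and B: "\<And>t. t \<in> closed_segment a b \<Longrightarrow> norm (iter_deriv 1 f t) \<le> B"
  shows "norm (f b - f a) \<le> B * \<bar>b - a\<bar>"
proof -
  have "norm (f b - f a) \<le> B * norm (b - a)"
  proof (rule differentiable_bound[where S="closed_segment a b"])
    fix t assume t: "t \<in> closed_segment a b"
    show "(f has_derivative (\<lambda>h. h *\<^sub>R iter_deriv 1 f t)) (at t within closed_segment a b)"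
      using smooth_fun_has_vector_derivative[OF f, of 0 t]
      by (simp add: has_vector_derivative_def has_derivative_at_withinI)
    show "onorm (\<lambda>h. h *\<^sub>R iter_deriv 1 f t) \<le> B"
      using mult_left_mono[OF B[OF t] abs_ge_zero] by (auto intro!: onorm_le simp: mult.commute)
  qed auto
  then show ?thesis by simp
qed

text \<open>The mean value bound applied twice, which loses only the factor \<open>1 / 2\<close> of the sharp estimate.
  The function \<open>g\<close> below has derivative \<open>f' - f'(a)\<close>.\<close>

lemma smooth_fun_taylor2:
  assumes f: "smooth_fun f" and M: "\<And>t. norm (iter_deriv 2 f t) \<le> M"
  shows "norm (f b - f a - of_real (b - a) * iter_deriv 1 f a) \<le> M * \<bar>b - a\<bar>\<^sup>2"
proof -
  define g where "g = (\<lambda>t. f t - poly [:0, iter_deriv 1 f a:] (of_real t))"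
  have g: "smooth_fun g" unfolding g_def by (intro iter_deriv_minus iter_deriv_poly f)
  have g1: "iter_deriv 1 g t = iter_deriv 1 f t - iter_deriv 1 f a" for t
    unfolding g_def iter_deriv_minus(2)[OF f iter_deriv_poly(1)] iter_deriv_poly(2)
    by (simp add: pderiv_pCons)
  have M0: "M \<ge> 0" using order_trans[OF norm_ge_zero M] .
  have "norm (g b - g a) \<le> (M * \<bar>b - a\<bar>) * \<bar>b - a\<bar>"
  proof (rule smooth_fun_mean_value[OF g])
    fix t assume t: "t \<in> closed_segment a b"
    have "norm (iter_deriv 1 f t - iter_deriv 1 f a) \<le> M * \<bar>t - a\<bar>"
      by (rule smooth_fun_mean_value[OF smooth_fun_iter_deriv[OF f]])
        (use M in \<open>simp add: iter_deriv_iter_deriv numeral_2_eq_2\<close>)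
    also have "\<dots> \<le> M * \<bar>b - a\<bar>"
      using t M0 by (intro mult_left_mono) (auto simp: closed_segment_eq_real_ivl split: if_splits)
    finally show "norm (iter_deriv 1 g t) \<le> M * \<bar>b - a\<bar>" by (simp only: g1)
  qed
  then show ?thesis by (simp add: g_def algebra_simps power2_eq_square)
qed

lemma poly_mult_exp_uminus_tendsto_0:
  "((\<lambda>t. poly p t * exp (- t)) \<longlongrightarrow> (0::real)) at_top"
proof -
  have "((\<lambda>t. \<Sum>i\<le>degree p. coeff p i * (t ^ i / exp t)) \<longlongrightarrow> 0) at_top"
    by (intro tendsto_null_sum tendsto_mult_right_zero tendsto_power_div_exp_0)
  then show ?thesis
    by (simp add: poly_altdef sum_distrib_right sum_divide_distrib exp_minus divide_inverse mult.assoc)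
qed

text \<open>For \<open>p = 1\<close> this is the standard smooth function that is not analytic at \<open>0\<close>. The polynomial
  factor makes the family closed under differentiation.\<close>

definition flat :: "real poly \<Rightarrow> real \<Rightarrow> real" where
  "flat p x = (if x > 0 then poly p (1 / x) * exp (- 1 / x) else 0)"

text \<open>Away from \<open>0\<close> this is the chain rule. At \<open>0\<close> the difference quotient from the right is, with
  \<open>t = 1 / h\<close>, a polynomial in \<open>t\<close> times \<open>exp (- t)\<close>.\<close>

lemma flat_has_derivative:
  "(flat p has_real_derivative flat ((p - pderiv p) * [:0, 0, 1:]) x) (at x)"
proof (cases x "0::real" rule: linorder_cases)
  case less
  have "((\<lambda>x. 0) has_real_derivative 0) (at x)" by simp
  then have "(flat p has_real_derivative 0) (at x)"
    by (rule has_field_derivative_transform_within_open[of _ _ _ "{..<0}"])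
      (use less in \<open>auto simp: flat_def\<close>)
  then show ?thesis using less by (simp add: flat_def)
next
  case greater
  have "((\<lambda>x. poly p (1 / x) * exp (- 1 / x)) has_real_derivative
      flat ((p - pderiv p) * [:0, 0, 1:]) x) (at x)"
  proof -
    have "((\<lambda>x. 1 / x) has_real_derivative - (1 / x\<^sup>2)) (at x)"
      using greater by (auto intro!: derivative_eq_intros simp: power2_eq_square)
    moreover have "((\<lambda>x. exp (- 1 / x)) has_real_derivative exp (- 1 / x) * (1 / x\<^sup>2)) (at x)"
      using greater by (auto intro!: derivative_eq_intros simp: power2_eq_square)
    ultimately have "((\<lambda>x. poly p (1 / x) * exp (- 1 / x)) has_real_derivative
        - (1 / x\<^sup>2) * poly (pderiv p) (1 / x) * exp (- 1 / x) +
        exp (- 1 / x) * (1 / x\<^sup>2) * poly p (1 / x)) (at x)"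
      by (intro DERIV_mult DERIV_chain'[where g="poly p", OF _ poly_DERIV, THEN DERIV_cong]) auto
    then show ?thesis
      using greater by (simp add: flat_def algebra_simps power2_eq_square)
  qed
  then show ?thesis
    by (rule has_field_derivative_transform_within_open[of _ _ _ "{0<..}"])
      (use greater in \<open>auto simp: flat_def\<close>)
next
  case equal
  have "((\<lambda>h. poly ([:0, 1:] * p) (inverse h) * exp (- inverse h)) \<longlongrightarrow> 0) (at_right 0)"
    by (rule filterlim_compose[OF poly_mult_exp_uminus_tendsto_0 filterlim_inverse_at_top_right])
  moreover have "\<forall>\<^sub>F h in at_right 0. poly ([:0, 1:] * p) (inverse h) * exp (- inverse h) = flat p h / h"
    using eventually_at_right_less[of 0] by eventually_elim (simp add: flat_def field_simps)
  ultimately have "((\<lambda>h. flat p h / h) \<longlongrightarrow> 0) (at_right 0)"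
    by (rule Lim_transform_eventually)
  moreover have "((\<lambda>h. flat p h / h) \<longlongrightarrow> 0) (at_left 0)"
    by (rule tendsto_eventually) (auto simp: eventually_at_filter flat_def)
  ultimately have "((\<lambda>h. flat p h / h) \<longlongrightarrow> 0) (at 0)"
    by (simp add: filterlim_at_split)
  then show ?thesis using equal by (simp add: DERIV_def flat_def)
qed

lemma smooth_fun_flat: "smooth_fun (\<lambda>x. of_real (flat p x))"
proof (rule smooth_fun_coinduct)
  show "(\<lambda>x. of_real (flat p x)) \<in> range (\<lambda>p x. complex_of_real (flat p x))" by blast
  fix g assume "g \<in> range (\<lambda>p x. complex_of_real (flat p x))"
  then obtain p where g: "g = (\<lambda>x. of_real (flat p x))" by blast
  have "(g has_vector_derivative of_real (flat ((p - pderiv p) * [:0, 0, 1:]) x)) (at x)" for x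
    unfolding g by (intro has_vector_derivative_of_real flat_has_derivative)
  then show "\<exists>g'\<in>range (\<lambda>p x. complex_of_real (flat p x)). \<forall>x. (g has_vector_derivative g' x) (at x)"
    by (intro bexI[of _ "\<lambda>x. of_real (flat ((p - pderiv p) * [:0, 0, 1:]) x)"]) auto
qed

text \<open>The quotients \<open>p / g ^ n\<close> with smooth \<open>p\<close> form a class closed under differentiation.\<close>

lemma smooth_fun_divide:
  assumes "smooth_fun f" and g: "smooth_fun g" and nz: "\<And>x. g x \<noteq> 0"
  shows "smooth_fun (\<lambda>x. f x / g x)"
proof (rule smooth_fun_coinduct)
  let ?X = "{h. \<exists>p n. smooth_fun p \<and> h = (\<lambda>x. p x * inverse (g x) ^ n)}"
  show "(\<lambda>x. f x / g x) \<in> ?X"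
    using assms(1) by (intro CollectI exI[of _ f] exI[of _ "Suc 0"]) (simp add: divide_inverse)
  fix h assume "h \<in> ?X"
  then obtain p n where p: "smooth_fun p" and h: "h = (\<lambda>x. p x * inverse (g x) ^ n)" by blast
  define p' g' where "p' = iter_deriv 1 p" and "g' = iter_deriv 1 g"
  define q where "q = (\<lambda>x. p' x * g x + (- of_nat n) * (p x * g' x))"
  have "(h has_vector_derivative q x * inverse (g x) ^ Suc n) (at x)" for x
  proof -
    have pw: "((\<lambda>w. inverse w ^ n) has_field_derivative - of_nat n * inverse (g x) ^ Suc n) (at (g x))"
      by (rule DERIV_cong[OF DERIV_power[OF DERIV_inverse[OF nz]]]) (cases n; simp add: algebra_simps)
    have g'x: "(g has_vector_derivative g' x) (at x)"
      using smooth_fun_has_vector_derivative[OF g, of 0] by (simp add: g'_def)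
    have "((\<lambda>x. inverse (g x) ^ n) has_vector_derivative
        g' x * (- of_nat n * inverse (g x) ^ Suc n)) (at x)"
      by (rule field_vector_diff_chain_at[OF g'x pw, unfolded o_def])
    moreover have "(p has_vector_derivative p' x) (at x)"
      using smooth_fun_has_vector_derivative[OF p, of 0] by (simp add: p'_def)
    ultimately have "(h has_vector_derivative
        p x * (g' x * (- of_nat n * inverse (g x) ^ Suc n)) + p' x * inverse (g x) ^ n) (at x)"
      unfolding h by (intro has_vector_derivative_mult)
    moreover have inv: "inverse (g x) ^ n = g x * inverse (g x) ^ Suc n" using nz[of x] by simp
    have "p x * (g' x * (- of_nat n * inverse (g x) ^ Suc n)) + p' x * inverse (g x) ^ n =
        q x * inverse (g x) ^ Suc n"
      unfolding inv q_def by (simp only: algebra_simps)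
    ultimately show ?thesis by simp
  qed
  moreover have "smooth_fun q"
    unfolding q_def p'_def g'_def
    by (intro iter_deriv_plus(1) iter_deriv_mult(1) iter_deriv_scale(1) smooth_fun_iter_deriv p g)
  ultimately show "\<exists>h'\<in>?X. \<forall>x. (h has_vector_derivative h' x) (at x)"
    by (intro bexI[of _ "\<lambda>x. q x * inverse (g x) ^ Suc n"] CollectI exI[of _ q] exI[of _ "Suc n"])
      auto
qed

lemma fun_supp_subset_iff:
  assumes "closed K"
  shows "fun_supp f \<subseteq> K \<longleftrightarrow> (\<forall>x. x \<notin> K \<longrightarrow> f x = 0)"
proof
  assume "fun_supp f \<subseteq> K"
  then show "\<forall>x. x \<notin> K \<longrightarrow> f x = 0"
    using closure_subset[of "{x. f x \<noteq> 0}"] unfolding fun_supp_def by blast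
next
  assume "\<forall>x. x \<notin> K \<longrightarrow> f x = 0"
  then show "fun_supp f \<subseteq> K"
    unfolding fun_supp_def by (intro closure_minimal assms) auto
qed

lemma fun_supp_disjoint_open:
  assumes "open U" and "\<And>x. x \<in> U \<Longrightarrow> f x = 0"
  shows "fun_supp f \<inter> U = {}"
proof -
  have "fun_supp f \<subseteq> - U"
    by (subst fun_supp_subset_iff) (use assms in auto)
  then show ?thesis by blast
qed

lemma test_fun_iff: "test_fun f \<longleftrightarrow> smooth_fun f \<and> (\<exists>L. \<forall>x. \<bar>x\<bar> > L \<longrightarrow> f x = 0)"
proof (intro iffI conjI)
  assume f: "test_fun f"
  then show "smooth_fun f" by (simp add: test_fun_def)
  from f have "bounded (fun_supp f)" by (simp add: test_fun_def compact_imp_bounded)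
  then obtain L where L: "\<And>x. x \<in> fun_supp f \<Longrightarrow> \<bar>x\<bar> \<le> L"
    unfolding bounded_real by blast
  show "\<exists>L. \<forall>x. \<bar>x\<bar> > L \<longrightarrow> f x = 0"
  proof (intro exI allI impI)
    fix x assume "\<bar>x\<bar> > L"
    then have "x \<notin> fun_supp f" using L[of x] by linarith
    moreover have "closed (fun_supp f)" by (simp add: fun_supp_def)
    ultimately show "f x = 0" using fun_supp_subset_iff[of "fun_supp f" f] by blast
  qed
next
  assume f: "smooth_fun f \<and> (\<exists>L. \<forall>x. \<bar>x\<bar> > L \<longrightarrow> f x = 0)"
  then obtain L where L: "\<And>x. \<bar>x\<bar> > L \<Longrightarrow> f x = 0" by blast
  have "f x = 0" if "x \<notin> {- L..L}" for x
    by (rule L) (use that in auto)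
  then have "fun_supp f \<subseteq> {- L..L}" by (simp add: fun_supp_subset_iff)
  then have "compact (fun_supp f)"
    unfolding compact_eq_bounded_closed
    by (metis bounded_closed_interval bounded_subset closed_closure fun_supp_def)
  with f show "test_fun f" by (simp add: test_fun_def)
qed

text \<open>With \<open>h\<close> the flat function, \<open>s x = h x / (h x + h (1 - x))\<close> is a smooth step that is \<open>0\<close> for
  \<open>x \<le> 0\<close> and \<open>1\<close> for \<open>x \<ge> 1\<close>; the cutoff is a product of two translated steps.\<close>

lemma cutoff_exists:
  obtains \<eta> where "test_fun \<eta>" and "\<And>x. \<bar>x\<bar> \<le> R \<Longrightarrow> \<eta> x = 1"
proof -
  define h where "h = (\<lambda>x. complex_of_real (flat 1 x))"
  define s where "s = (\<lambda>x. h x / (h x + h (1 - x)))"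
  have h: "smooth_fun h" unfolding h_def by (rule smooth_fun_flat)
  have hm: "smooth_fun (\<lambda>x. h (1 - x))" using iter_deriv_affine(1)[OF h, of "-1" 1] by simp
  have nz: "h x + h (1 - x) \<noteq> 0" for x
  proof -
    have "flat 1 x \<ge> 0" "flat 1 (1 - x) \<ge> 0" "x > 0 \<Longrightarrow> flat 1 x > 0" "x < 1 \<Longrightarrow> flat 1 (1 - x) > 0"
      by (auto simp: flat_def)
    then have "flat 1 x + flat 1 (1 - x) \<noteq> 0" by (cases "x > 0") linarith+
    then show ?thesis unfolding h_def by (metis of_real_add of_real_eq_0_iff)
  qed
  have s: "smooth_fun s"
    unfolding s_def by (intro smooth_fun_divide iter_deriv_plus(1) h hm nz)
  have s0: "s x = 0" if "x \<le> 0" for x using that by (simp add: s_def h_def flat_def)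
  have s1: "s x = 1" if "x \<ge> 1" for x
    using that nz[of x] by (simp add: s_def h_def flat_def)
  define \<eta> where "\<eta> = (\<lambda>x. s ((-1) * x + (R + 1)) * s (1 * x + (R + 1)))"
  have "smooth_fun \<eta>" unfolding \<eta>_def by (intro iter_deriv_mult(1) iter_deriv_affine(1) s)
  moreover have "\<forall>x. \<bar>x\<bar> > R + 1 \<longrightarrow> \<eta> x = 0"
    by (auto simp: \<eta>_def s0 abs_if split: if_splits)
  ultimately have "test_fun \<eta>" unfolding test_fun_iff by blast
  moreover have "\<eta> x = 1" if "\<bar>x\<bar> \<le> R" for x
    using that by (auto simp: \<eta>_def s1)
  ultimately show ?thesis by (rule that)
qed

lemma polynomial_approximation:
  fixes f :: "real \<Rightarrow> complex"
  assumes "continuous_on {- L..L} f" and "e > 0"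
  obtains p :: "complex poly" where "\<And>x. \<bar>x\<bar> \<le> L \<Longrightarrow> norm (f x - poly p (of_real x)) \<le> e"
proof -
  have "\<exists>p. \<forall>x. \<bar>x\<bar> \<le> L \<longrightarrow> norm (of_real (g x) - poly p (complex_of_real x)) \<le> e / 2"
    if g: "continuous_on {- L..L} g" for g
  proof -
    obtain q where "real_polynomial_function q" and q: "\<And>x. x \<in> {- L..L} \<Longrightarrow> \<bar>g x - q x\<bar> < e / 2"
      using Stone_Weierstrass_real_polynomial_function[OF compact_Icc g, of "e / 2"] assms(2) by auto
    then obtain a n where qa: "q = (\<lambda>x. \<Sum>i\<le>n. a i * x ^ i)"
      unfolding real_polynomial_function_iff_sum by blast
    define p where "p = (\<Sum>i\<le>n. monom (complex_of_real (a i)) i)"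
    have p: "poly p (of_real x) = of_real (q x)" for x
      by (simp add: p_def qa poly_sum poly_monom)
    have "norm (of_real (g x) - poly p (complex_of_real x)) \<le> e / 2" if "\<bar>x\<bar> \<le> L" for x
      using q[of x] that unfolding p by (auto simp: abs_le_iff simp flip: of_real_diff)
    then show ?thesis by blast
  qed
  from this[OF continuous_on_Re[OF assms(1)]] this[OF continuous_on_Im[OF assms(1)]] obtain p q
    where p: "\<And>x. \<bar>x\<bar> \<le> L \<Longrightarrow> norm (of_real (Re (f x)) - poly p (complex_of_real x)) \<le> e / 2"
      and q: "\<And>x. \<bar>x\<bar> \<le> L \<Longrightarrow> norm (of_real (Im (f x)) - poly q (complex_of_real x)) \<le> e / 2"
    by blast
  have "norm (f x - poly (p + smult \<i> q) (of_real x)) \<le> e" if "\<bar>x\<bar> \<le> L" for x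
  proof -
    have "f x - poly (p + smult \<i> q) (of_real x) =
        (of_real (Re (f x)) - poly p (of_real x)) + \<i> * (of_real (Im (f x)) - poly q (of_real x))"
      using complex_eq[of "f x"] by (simp add: algebra_simps)
    also have "norm \<dots> \<le> e / 2 + e / 2"
      by (rule norm_triangle_mono) (use p q that in \<open>auto simp: norm_mult\<close>)
    finally show ?thesis by simp
  qed
  then show ?thesis by (rule that)
qed

lemma poly_antiderivative:
  fixes q :: "complex poly"
  obtains p where "pderiv p = q"
proof
  show "pderiv (\<Sum>i\<le>degree q. monom (coeff q i / of_nat (Suc i)) (Suc i)) = q"
    by (simp add: higher_pderiv_sum[of 1, simplified] pderiv_monom poly_as_sum_of_monoms del: of_nat_Suc)
qed

text \<open>Weierstrass approximation together with finitely many derivatives: approximate the derivative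
  and integrate, with the constant chosen so that the error vanishes at \<open>0\<close>. On \<open>[-L, L]\<close> the error
  of the integral is at most \<open>L\<close> times that of the derivative.\<close>

lemma smooth_polynomial_approximation:
  assumes "smooth_fun f" and "e > 0" and "L > 0"
  obtains p :: "complex poly" where "\<And>k x. k \<le> N \<Longrightarrow> \<bar>x\<bar> \<le> L \<Longrightarrow>
    norm (iter_deriv k (\<lambda>x. f x - poly p (of_real x)) x) \<le> e"
proof -
  have "\<exists>p. \<forall>k\<le>N. \<forall>x. \<bar>x\<bar> \<le> L \<longrightarrow>
      norm (iter_deriv k (\<lambda>x. f x - poly p (complex_of_real x)) x) \<le> e"
    using assms(1,2)
  proof (induction N arbitrary: f e)
    case 0
    have "continuous_on {- L..L} f"
      using smooth_fun_has_vector_derivative[OF 0(1), of 0]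
      by (auto intro!: continuous_at_imp_continuous_on has_vector_derivative_continuous)
    from polynomial_approximation[OF this 0(2)] show ?case by force
  next
    case (Suc N)
    have f': "smooth_fun (iter_deriv 1 f)" by (intro smooth_fun_iter_deriv Suc.prems)
    \<comment> \<open>the derivatives need \<open>d \<le> e\<close>, the integrated error \<open>d * L \<le> e\<close>\<close>
    define d where "d = min e (e / L)"
    have d: "d > 0" "d \<le> e" "d * L \<le> e"
      using Suc.prems assms(3) by (auto simp: d_def min_def field_simps)
    obtain q where q: "\<And>k x. k \<le> N \<Longrightarrow> \<bar>x\<bar> \<le> L \<Longrightarrow>
        norm (iter_deriv k (\<lambda>x. iter_deriv 1 f x - poly q (complex_of_real x)) x) \<le> d"
      using Suc.IH[OF f' d(1)] by blast
    obtain p where p: "pderiv p = q" by (rule poly_antiderivative)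
    define r where "r = p + [:f 0 - poly p 0:]"
    define g where "g = (\<lambda>x. f x - poly r (complex_of_real x))"
    have g: "smooth_fun g" unfolding g_def by (intro iter_deriv_minus iter_deriv_poly Suc.prems)
    have g1: "iter_deriv 1 g = (\<lambda>x. iter_deriv 1 f x - poly q (complex_of_real x))"
      unfolding g_def iter_deriv_minus(2)[OF Suc.prems(1) iter_deriv_poly(1)] iter_deriv_poly(2)
      by (simp add: r_def p pderiv_add)
    have g0: "g 0 = 0" by (simp add: g_def r_def)
    have higher: "norm (iter_deriv k g x) \<le> d" if "1 \<le> k" "k \<le> Suc N" "\<bar>x\<bar> \<le> L" for k x
    proof -
      have eq: "iter_deriv k g = iter_deriv (k - 1) (iter_deriv 1 g)"
        using that(1) by (simp add: iter_deriv_iter_deriv)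
      show ?thesis unfolding eq g1 by (rule q) (use that in auto)
    qed
    have zeroth: "norm (g x) \<le> e" if "\<bar>x\<bar> \<le> L" for x
    proof -
      have "norm (g x - g 0) \<le> d * \<bar>x - 0\<bar>"
        by (rule smooth_fun_mean_value[OF g]) (use higher[of 1] that in \<open>auto simp: closed_segment_eq_real_ivl split: if_splits\<close>)
      also have "\<dots> \<le> d * L" using that d by (intro mult_left_mono) auto
      finally show ?thesis using d(3) g0 by simp
    qed
    have "norm (iter_deriv k g x) \<le> e" if "k \<le> Suc N" "\<bar>x\<bar> \<le> L" for k x
      using zeroth[OF that(2)] higher[OF _ that] d(2) by (cases k) (auto intro: order_trans)
    then show ?case unfolding g_def by blast
  qed
  then show ?thesis using that by blast
qed

section \<open>Compactly supported distributions and their extension to smooth functions\<close>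

lemma test_fun_smooth: "test_fun f \<Longrightarrow> smooth_fun f"
  by (simp add: test_fun_def)

lemma test_fun_support:
  assumes "test_fun f"
  obtains L where "L > 0" "\<And>x. \<bar>x\<bar> > L \<Longrightarrow> f x = 0"
proof -
  from assms obtain L where "\<forall>x. \<bar>x\<bar> > L \<longrightarrow> f x = 0" unfolding test_fun_iff by blast
  then show ?thesis by (intro that[of "max L 1"]) auto
qed

lemma test_fun_plus:
  assumes "test_fun f" "test_fun g"
  shows "test_fun (\<lambda>x. f x + g x)"
proof -
  obtain L M where "\<And>x. \<bar>x\<bar> > L \<Longrightarrow> f x = 0" "\<And>x. \<bar>x\<bar> > M \<Longrightarrow> g x = 0"
    using assms by (metis test_fun_support)
  then have "\<forall>x. \<bar>x\<bar> > max L M \<longrightarrow> f x + g x = 0" by simp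
  with assms show ?thesis unfolding test_fun_iff by (blast intro: iter_deriv_plus(1))
qed

lemma test_fun_mult:
  assumes f: "test_fun f" and g: "smooth_fun g"
  shows "test_fun (\<lambda>x. f x * g x)" and "test_fun (\<lambda>x. g x * f x)"
proof -
  obtain L where L: "\<And>x. \<bar>x\<bar> > L \<Longrightarrow> f x = 0" using test_fun_support[OF f] by metis
  have "smooth_fun (\<lambda>x. f x * g x)"
    by (intro iter_deriv_mult test_fun_smooth f g)
  moreover have "\<forall>x. \<bar>x\<bar> > L \<longrightarrow> f x * g x = 0" using L by simp
  ultimately show "test_fun (\<lambda>x. f x * g x)" unfolding test_fun_iff by blast
  then show "test_fun (\<lambda>x. g x * f x)" by (simp add: mult.commute)
qed

lemma test_fun_scale: "test_fun f \<Longrightarrow> test_fun (\<lambda>x. c * f x)"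
  by (intro test_fun_mult(2) smooth_fun_const)

lemma test_fun_minus: "test_fun f \<Longrightarrow> test_fun g \<Longrightarrow> test_fun (\<lambda>x. f x - g x)"
  using test_fun_plus[OF _ test_fun_scale[of g "-1"], of f] by simp

lemma iter_deriv_eq_0:
  assumes "\<And>x. \<bar>x\<bar> > L \<Longrightarrow> f x = 0" and "\<bar>x\<bar> > L"
  shows "iter_deriv k f x = 0"
proof -
  have "open {x::real. \<bar>x\<bar> > L}" by (intro open_Collect_less continuous_intros)
  then have "iter_deriv k f x = iter_deriv k (\<lambda>x. poly 0 (of_real x)) x"
    by (rule iter_deriv_cong_open) (use assms in auto)
  also have "\<dots> = 0" unfolding iter_deriv_poly(2) higher_pderiv_0 by simp
  finally show ?thesis .
qed

lemma test_fun_iter_deriv: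
  assumes "test_fun f"
  shows "test_fun (iter_deriv k f)"
proof -
  obtain L where "\<And>x. \<bar>x\<bar> > L \<Longrightarrow> f x = 0" using test_fun_support[OF assms] by metis
  then have "\<forall>x. \<bar>x\<bar> > L \<longrightarrow> iter_deriv k f x = 0" using iter_deriv_eq_0[of L f] by blast
  with smooth_fun_iter_deriv[OF test_fun_smooth[OF assms]] show ?thesis
    unfolding test_fun_iff by blast
qed

lemma test_fun_affine:
  assumes f: "test_fun f" and "a \<noteq> 0"
  shows "test_fun (\<lambda>x. f (a * x + b))"
proof -
  obtain L where L: "\<And>x. \<bar>x\<bar> > L \<Longrightarrow> f x = 0" using test_fun_support[OF f] by metis
  have "f (a * x + b) = 0" if "\<bar>x\<bar> > (L + \<bar>b\<bar>) / \<bar>a\<bar>" for x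
  proof (rule L)
    have "L + \<bar>b\<bar> < \<bar>a * x\<bar>" using that assms(2) by (simp add: field_simps abs_mult)
    then show "L < \<bar>a * x + b\<bar>" by linarith
  qed
  then show ?thesis
    unfolding test_fun_iff using iter_deriv_affine(1)[OF test_fun_smooth[OF f]] by blast
qed

lemma test_fun_derivs_bounded:
  assumes "test_fun f"
  obtains M where "M \<ge> 0" "\<And>k x. k \<le> N \<Longrightarrow> norm (iter_deriv k f x) \<le> M"
proof -
  obtain L where L: "\<And>x. \<bar>x\<bar> > L \<Longrightarrow> f x = 0" using test_fun_support[OF assms] by metis
  have "\<exists>M. \<forall>x. norm (iter_deriv k f x) \<le> M" for k
  proof -
    have "continuous_on {- L..L} (iter_deriv k f)"
      using smooth_fun_has_vector_derivative[OF test_fun_smooth[OF assms], of k]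
      by (intro continuous_at_imp_continuous_on ballI has_vector_derivative_continuous)
    then have "bounded (iter_deriv k f ` {- L..L})"
      by (intro compact_imp_bounded compact_continuous_image compact_Icc)
    then obtain M where M: "\<And>x. x \<in> {- L..L} \<Longrightarrow> norm (iter_deriv k f x) \<le> M"
      unfolding bounded_iff by blast
    have "norm (iter_deriv k f x) \<le> max M 0" for x
    proof (cases "\<bar>x\<bar> > L")
      case True
      then show ?thesis using iter_deriv_eq_0[OF L] by simp
    next
      case False
      then show ?thesis using M[of x] by (auto simp: abs_le_iff le_max_iff_disj not_less)
    qed
    then show ?thesis by blast
  qed
  then obtain M where M: "\<And>k x. norm (iter_deriv k f x) \<le> M k" by metis
  show ?thesis
  proof
    have "M k \<ge> 0" for k using order_trans[OF norm_ge_zero M] .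
    then show "(\<Sum>k\<le>N. M k) \<ge> 0" by (intro sum_nonneg)
    show "norm (iter_deriv k f x) \<le> (\<Sum>k\<le>N. M k)" if "k \<le> N" for k x
      using that \<open>\<And>k. M k \<ge> 0\<close> by (intro order_trans[OF M] member_le_sum) auto
  qed
qed

lemma compact_real_abs_bound:
  fixes K :: "real set"
  assumes "compact K"
  shows "\<exists>r. \<forall>x\<in>K. \<bar>x\<bar> \<le> r"
  using compact_imp_bounded[OF assms] by (simp add: bounded_real)

text \<open>A form of the continuity estimate that is more convenient to use than the sum of suprema: test
  functions are measured by a common bound on their derivatives. With \<open>distributionI\<close> it
  characterises the original condition.\<close>

lemma distribution_bound:
  assumes "distribution T"
  obtains C N where "C \<ge> 0"
    "\<And>f B. \<lbrakk>test_fun f; \<And>x. \<bar>x\<bar> > L \<Longrightarrow> f x = 0;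
      \<And>k x. k \<le> N \<Longrightarrow> norm (iter_deriv k f x) \<le> B\<rbrakk> \<Longrightarrow> norm (T f) \<le> C * B"
proof -
  from assms have "\<forall>K. compact K \<longrightarrow>
      (\<exists>C N. \<forall>f. test_fun f \<longrightarrow> fun_supp f \<subseteq> K \<longrightarrow>
           norm (T f) \<le> C * (\<Sum>k\<le>N. SUP x. norm (iter_deriv k f x)))"
    by (simp add: distribution_def)
  then obtain C N where CN: "\<And>f. test_fun f \<Longrightarrow> fun_supp f \<subseteq> {- L..L} \<Longrightarrow>
      norm (T f) \<le> C * (\<Sum>k\<le>N. SUP x. norm (iter_deriv k f x))"
    using compact_Icc by metis
  show ?thesis
  proof
    show "\<bar>C\<bar> * real (Suc N) \<ge> 0" by simp
    fix f B assume f: "test_fun f" and L: "\<And>x. \<bar>x\<bar> > L \<Longrightarrow> f x = 0"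
      and B: "\<And>k x. k \<le> N \<Longrightarrow> norm (iter_deriv k f x) \<le> B"
    have "f x = 0" if "x \<notin> {- L..L}" for x
      by (rule L) (use that in auto)
    then have "norm (T f) \<le> C * (\<Sum>k\<le>N. SUP x. norm (iter_deriv k f x))"
      by (intro CN f) (simp add: fun_supp_subset_iff)
    also have "\<dots> \<le> \<bar>C\<bar> * (real (Suc N) * B)"
    proof (rule mult_mono)
      show "0 \<le> (\<Sum>k\<le>N. SUP x. norm (iter_deriv k f x))"
      proof (intro sum_nonneg)
        fix k assume "k \<in> {..N}"
        then have "bdd_above (range (\<lambda>x. norm (iter_deriv k f x)))"
          using B by (intro bdd_aboveI2[where M=B]) auto
        then show "0 \<le> (SUP x. norm (iter_deriv k f x))"
          by (rule cSUP_upper2[of _ _ 0]) auto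
      qed
      have "(\<Sum>k\<le>N. SUP x. norm (iter_deriv k f x)) \<le> (\<Sum>k\<le>N. B)"
        using B by (intro sum_mono cSUP_least) auto
      then show "(\<Sum>k\<le>N. SUP x. norm (iter_deriv k f x)) \<le> real (Suc N) * B" by simp
    qed auto
    finally show "norm (T f) \<le> \<bar>C\<bar> * real (Suc N) * B" by (simp add: mult.assoc)
  qed
qed

lemma distributionI:
  assumes "\<And>f g. test_fun f \<Longrightarrow> test_fun g \<Longrightarrow> T (\<lambda>x. f x + g x) = T f + T g"
    and "\<And>c f. test_fun f \<Longrightarrow> T (\<lambda>x. c * f x) = c * T f"
    and bound: "\<And>L. \<exists>C N. \<forall>f B. test_fun f \<longrightarrow> (\<forall>x. \<bar>x\<bar> > L \<longrightarrow> f x = 0) \<longrightarrow>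
      (\<forall>k\<le>N. \<forall>x. norm (iter_deriv k f x) \<le> B) \<longrightarrow> norm (T f) \<le> C * B"
  shows "distribution T"
proof -
  have "\<exists>C N. \<forall>f. test_fun f \<longrightarrow> fun_supp f \<subseteq> K \<longrightarrow>
      norm (T f) \<le> C * (\<Sum>k\<le>N. SUP x. norm (iter_deriv k f x))" if "compact K" for K
  proof -
    from that obtain L where L: "\<And>x. x \<in> K \<Longrightarrow> \<bar>x\<bar> \<le> L"
      using compact_real_abs_bound by blast
    obtain C N where CN: "\<And>f B. \<lbrakk>test_fun f; \<forall>x. \<bar>x\<bar> > L \<longrightarrow> f x = 0;
        \<forall>k\<le>N. \<forall>x. norm (iter_deriv k f x) \<le> B\<rbrakk> \<Longrightarrow> norm (T f) \<le> C * B"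
      using bound[of L] by metis
    have "norm (T f) \<le> C * (\<Sum>k\<le>N. SUP x. norm (iter_deriv k f x))"
      if f: "test_fun f" and K: "fun_supp f \<subseteq> K" for f
    proof (rule CN[OF f]; intro allI impI)
      have "fun_supp f \<subseteq> {- L..L}" using K L by (force simp: abs_le_iff)
      then show "f x = 0" if "\<bar>x\<bar> > L" for x
        using that by (auto simp: fun_supp_subset_iff abs_if split: if_splits)
      fix k x assume "k \<le> N"
      have upper: "norm (iter_deriv j f y) \<le> (SUP x. norm (iter_deriv j f x))" for j y
      proof -
        obtain M where "\<And>k x. k \<le> j \<Longrightarrow> norm (iter_deriv k f x) \<le> M"
          using test_fun_derivs_bounded[OF f] by metis
        then have "bdd_above (range (\<lambda>x. norm (iter_deriv j f x)))"
          by (intro bdd_aboveI2[where M=M]) auto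
        then show ?thesis by (rule cSUP_upper[rotated]) simp
      qed
      have "0 \<le> (SUP x. norm (iter_deriv j f x))" for j
        using order_trans[OF norm_ge_zero upper] .
      with \<open>k \<le> N\<close> have "(SUP x. norm (iter_deriv k f x)) \<le> (\<Sum>k\<le>N. SUP x. norm (iter_deriv k f x))"
        by (intro member_le_sum) auto
      with upper show "norm (iter_deriv k f x) \<le> (\<Sum>k\<le>N. SUP x. norm (iter_deriv k f x))"
        by (rule order_trans)
    qed
    then show ?thesis by blast
  qed
  with assms(1,2) show ?thesis unfolding distribution_def by blast
qed

lemma distribution_linear:
  assumes T: "distribution T" and f: "test_fun f"
  shows "test_fun g \<Longrightarrow> T (\<lambda>x. f x + g x) = T f + T g"
    and "T (\<lambda>x. c * f x) = c * T f"
    and "test_fun g \<Longrightarrow> T (\<lambda>x. f x - g x) = T f - T g"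
proof -
  show add: "T (\<lambda>x. f x + g x) = T f + T g" if "test_fun g" for g
    using T f that unfolding distribution_def by blast
  show "T (\<lambda>x. c * f x) = c * T f"
    using T f unfolding distribution_def by blast
  assume g: "test_fun g"
  have "T (\<lambda>x. -1 * g x) = -1 * T g"
    using T g unfolding distribution_def by metis
  then show "T (\<lambda>x. f x - g x) = T f - T g"
    using add[OF test_fun_scale[OF g, of "-1"]] by simp
qed

text \<open>Supports are recorded only through a symmetric interval containing them: radii add under
  convolution and scale under dilation. Test functions that vanish on the open interval are allowed,
  so that agreement on \<open>\<bar>x\<bar> < R\<close> suffices in the comparisons below.\<close>

definition null_outside :: "((real \<Rightarrow> complex) \<Rightarrow> complex) \<Rightarrow> real \<Rightarrow> bool" where
  "null_outside T R \<longleftrightarrow> (\<forall>f. test_fun f \<longrightarrow> (\<forall>x. \<bar>x\<bar> < R \<longrightarrow> f x = 0) \<longrightarrow> T f = 0)"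

lemma compactly_supported_null_outside:
  assumes "compactly_supported_distribution T"
  obtains R where "R > 0" "null_outside T R"
proof -
  from assms obtain K where K: "compact K" "vanishes_off T K"
    unfolding compactly_supported_distribution_def by blast
  then obtain r where r: "\<And>x. x \<in> K \<Longrightarrow> \<bar>x\<bar> \<le> r"
    using compact_real_abs_bound by blast
  have "T f = 0" if f: "test_fun f" "\<And>x. \<bar>x\<bar> < max r 0 + 1 \<Longrightarrow> f x = 0" for f
  proof -
    have "open {x::real. \<bar>x\<bar> < max r 0 + 1}" by (intro open_Collect_less continuous_intros)
    from fun_supp_disjoint_open[OF this, of f] f(2)
    have "fun_supp f \<inter> {x. \<bar>x\<bar> < max r 0 + 1} = {}" by simp
    moreover have "K \<subseteq> {x. \<bar>x\<bar> < max r 0 + 1}" using r by force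
    ultimately show ?thesis
      using K(2) f(1) unfolding vanishes_off_def by blast
  qed
  then show ?thesis by (intro that[of "max r 0 + 1"]) (auto simp: null_outside_def)
qed

lemma null_outside_compactly_supported:
  assumes "distribution T" and R: "null_outside T R"
  shows "compactly_supported_distribution T"
proof -
  have "vanishes_off T {- R..R}"
    unfolding vanishes_off_def
  proof (intro allI impI)
    fix f assume f: "test_fun f" "fun_supp f \<inter> {- R..R} = {}"
    have "f x = 0" if "\<bar>x\<bar> < R" for x
    proof -
      have "x \<in> {- R..R}" using that by auto
      then have "x \<notin> fun_supp f" using f(2) by blast
      moreover have "closed (fun_supp f)" by (simp add: fun_supp_def)
      ultimately show ?thesis using fun_supp_subset_iff[of "fun_supp f" f] by blast
    qed
    then show "T f = 0" using R f(1) unfolding null_outside_def by blast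
  qed
  with assms(1) show ?thesis
    unfolding compactly_supported_distribution_def using compact_Icc by blast
qed

lemma null_outside_cong:
  assumes "distribution T" "null_outside T R" "test_fun f" "test_fun g"
    and "\<And>x. \<bar>x\<bar> < R \<Longrightarrow> f x = g x"
  shows "T f = T g"
proof -
  have "T (\<lambda>x. f x - g x) = 0"
    using assms test_fun_minus[of f g] unfolding null_outside_def by auto
  then show ?thesis using distribution_linear(3)[OF assms(1,3,4)] by simp
qed

text \<open>The value of the extension can be computed with any test function that agrees with \<open>f\<close> near the
  support. The cutoff chosen in the definition of \<open>pairing\<close> refers to some other compact set \<open>K\<close> off
  which \<open>T\<close> vanishes, so both descriptions of the support are used, one for each of the two
  replacements in \<open>\<eta> f \<rightarrow> \<eta> g \<rightarrow> g\<close>.\<close>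

lemma pairing_eq:
  assumes T: "compactly_supported_distribution T" and R: "null_outside T R"
    and f: "smooth_fun f" and g: "test_fun g" and eq: "\<And>x. \<bar>x\<bar> < R \<Longrightarrow> g x = f x"
  shows "pairing T f = T g"
proof -
  have dist: "distribution T" using T by (simp add: compactly_supported_distribution_def)
  obtain K where K: "compact K" "vanishes_off T K"
    using T unfolding compactly_supported_distribution_def by blast
  obtain r where r: "\<And>x. x \<in> K \<Longrightarrow> \<bar>x\<bar> \<le> r"
    using compact_real_abs_bound[OF K(1)] by blast
  obtain \<theta> where \<theta>: "test_fun \<theta>" "\<And>x. \<bar>x\<bar> \<le> r + 1 \<Longrightarrow> \<theta> x = 1" using cutoff_exists[of "r + 1"] by blast
  have "cutoff_for T \<theta>"
    unfolding cutoff_for_def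
  proof (intro conjI exI)
    show "open {x::real. \<bar>x\<bar> < r + 1}" by (intro open_Collect_less continuous_intros)
    show "K \<subseteq> {x. \<bar>x\<bar> < r + 1}" using r by force
  qed (use K \<theta> in auto)
  define \<eta> where "\<eta> = (SOME \<eta>. cutoff_for T \<eta>)"
  have "cutoff_for T \<eta>" unfolding \<eta>_def using someI[of "cutoff_for T", OF \<open>cutoff_for T \<theta>\<close>] .
  then obtain K U where \<eta>: "test_fun \<eta>" and K: "vanishes_off T K"
    and U: "open U" "K \<subseteq> U" "\<And>x. x \<in> U \<Longrightarrow> \<eta> x = 1"
    unfolding cutoff_for_def by blast
  have g': "smooth_fun g" and \<eta>': "smooth_fun \<eta>" using g \<eta> by (auto intro: test_fun_smooth)
  have \<eta>f: "test_fun (\<lambda>x. \<eta> x * f x)" and \<eta>g: "test_fun (\<lambda>x. \<eta> x * g x)"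
    by (intro test_fun_mult \<eta> f g')+
  have "pairing T f = T (\<lambda>x. \<eta> x * f x)" by (simp add: pairing_def \<eta>_def)
  also have "\<dots> = T (\<lambda>x. \<eta> x * g x)"
    using eq by (intro null_outside_cong[OF dist R] \<eta>f \<eta>g) auto
  also have "\<dots> = T g"
  proof -
    have "fun_supp (\<lambda>x. \<eta> x * g x - g x) \<inter> U = {}"
      by (rule fun_supp_disjoint_open) (use U in auto)
    then have "T (\<lambda>x. \<eta> x * g x - g x) = 0"
      using K U(2) test_fun_minus[OF \<eta>g g] unfolding vanishes_off_def by blast
    then show ?thesis using distribution_linear(3)[OF dist \<eta>g g] by simp
  qed
  finally show ?thesis .
qed

lemma pairing_eq_cutoff:
  assumes "compactly_supported_distribution T"
  obtains \<eta> where "test_fun \<eta>" "\<And>f. smooth_fun f \<Longrightarrow> pairing T f = T (\<lambda>x. \<eta> x * f x)"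
proof -
  obtain R where R: "null_outside T R" using compactly_supported_null_outside[OF assms] .
  obtain \<eta> where \<eta>: "test_fun \<eta>" "\<And>x. \<bar>x\<bar> \<le> R \<Longrightarrow> \<eta> x = 1" using cutoff_exists[of R] by blast
  show ?thesis
  proof
    fix f assume "smooth_fun f"
    then show "pairing T f = T (\<lambda>x. \<eta> x * f x)"
      by (intro pairing_eq[OF assms R] test_fun_mult \<eta>(1)) (auto simp: \<eta>)
  qed (rule \<eta>)
qed

lemma pairing_test_fun:
  assumes T: "compactly_supported_distribution T" and "test_fun f"
  shows "pairing T f = T f"
proof -
  obtain R where R: "null_outside T R" using compactly_supported_null_outside[OF T] .
  from pairing_eq[OF T R] assms(2) show ?thesis by (simp add: test_fun_smooth)
qed

lemma pairing_linear:
  assumes T: "compactly_supported_distribution T" and f: "smooth_fun f"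
  shows "smooth_fun g \<Longrightarrow> pairing T (\<lambda>x. f x + g x) = pairing T f + pairing T g"
    and "pairing T (\<lambda>x. c * f x) = c * pairing T f"
    and "smooth_fun g \<Longrightarrow> pairing T (\<lambda>x. f x - g x) = pairing T f - pairing T g"
proof -
  obtain \<eta> where \<eta>: "test_fun \<eta>" and eq: "\<And>f. smooth_fun f \<Longrightarrow> pairing T f = T (\<lambda>x. \<eta> x * f x)"
    using pairing_eq_cutoff[OF T] by blast
  have dist: "distribution T" using T by (simp add: compactly_supported_distribution_def)
  note lin = distribution_linear[OF dist test_fun_mult(1)[OF \<eta> f]]
  show "pairing T (\<lambda>x. c * f x) = c * pairing T f"
    using lin(2)[of c] by (simp add: eq f iter_deriv_scale mult.left_commute)
  assume g: "smooth_fun g"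
  note eg = test_fun_mult(1)[OF \<eta> g]
  show "pairing T (\<lambda>x. f x + g x) = pairing T f + pairing T g"
    using lin(1)[OF eg] by (simp add: eq f g iter_deriv_plus distrib_left)
  show "pairing T (\<lambda>x. f x - g x) = pairing T f - pairing T g"
    using lin(3)[OF eg] by (simp add: eq f g iter_deriv_minus right_diff_distrib)
qed

lemma pairing_sum:
  assumes T: "compactly_supported_distribution T" and "\<And>i. i \<in> I \<Longrightarrow> smooth_fun (f i)"
  shows "pairing T (\<lambda>x. \<Sum>i\<in>I. c i * f i x) = (\<Sum>i\<in>I. c i * pairing T (f i))"
  using assms(2)
proof (induction I rule: infinite_finite_induct)
  case (insert i I)
  have "smooth_fun (\<lambda>x. c i * f i x)" "smooth_fun (\<lambda>x. \<Sum>i\<in>I. c i * f i x)"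
    using insert.prems by (auto intro!: iter_deriv_scale smooth_fun_sum)
  then show ?case
    using insert by (simp add: pairing_linear[OF T])
next
  case empty
  show ?case using pairing_linear(2)[OF T smooth_fun_const[of 0], of 0] by simp
next
  case (infinite I)
  then show ?case using pairing_linear(2)[OF T smooth_fun_const[of 0], of 0] by simp
qed

text \<open>A compactly supported distribution has finite order: \<open>pairing T f = T (\<eta> f)\<close> for a cutoff \<open>\<eta>\<close>, and
  the Leibniz rule bounds the derivatives of \<open>\<eta> f\<close> by those of \<open>f\<close> on the support of \<open>\<eta>\<close>.\<close>

lemma pairing_bound:
  assumes T: "compactly_supported_distribution T"
  obtains C N L where "C \<ge> 0" "L > 0" "\<And>f B. \<lbrakk>smooth_fun f;
    \<And>k x. k \<le> N \<Longrightarrow> \<bar>x\<bar> \<le> L \<Longrightarrow> norm (iter_deriv k f x) \<le> B\<rbrakk> \<Longrightarrow> norm (pairing T f) \<le> C * B"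
proof -
  obtain \<eta> where \<eta>: "test_fun \<eta>" and eq: "\<And>f. smooth_fun f \<Longrightarrow> pairing T f = T (\<lambda>x. \<eta> x * f x)"
    using pairing_eq_cutoff[OF T] by blast
  have dist: "distribution T" using T by (simp add: compactly_supported_distribution_def)
  obtain L where L: "L > 0" "\<And>x. \<bar>x\<bar> > L \<Longrightarrow> \<eta> x = 0" using test_fun_support[OF \<eta>] by blast
  obtain C N where C: "C \<ge> 0" and CN: "\<And>f B. \<lbrakk>test_fun f; \<And>x. \<bar>x\<bar> > L \<Longrightarrow> f x = 0;
      \<And>k x. k \<le> N \<Longrightarrow> norm (iter_deriv k f x) \<le> B\<rbrakk> \<Longrightarrow> norm (T f) \<le> C * B"
    using distribution_bound[OF dist, of L] by metis
  obtain M where M: "M \<ge> 0" "\<And>k x. k \<le> N \<Longrightarrow> norm (iter_deriv k \<eta> x) \<le> M"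
    using test_fun_derivs_bounded[OF \<eta>] by blast
  show ?thesis
  proof
    show "C * (2 ^ N * M) \<ge> 0" using C M by simp
    show "L > 0" by (rule L)
    fix f B assume f: "smooth_fun f"
      and B: "\<And>k x. k \<le> N \<Longrightarrow> \<bar>x\<bar> \<le> L \<Longrightarrow> norm (iter_deriv k f x) \<le> B"
    have B0: "B \<ge> 0" using order_trans[OF norm_ge_zero B[of 0 0]] L(1) by simp
    have zero: "\<eta> x * f x = 0" if "\<bar>x\<bar> > L" for x using L(2)[OF that] by simp
    have "norm (T (\<lambda>x. \<eta> x * f x)) \<le> C * (2 ^ N * M * B)"
    proof (rule CN[OF test_fun_mult(1)[OF \<eta> f] zero])
      fix k x assume k: "k \<le> N"
      show "norm (iter_deriv k (\<lambda>x. \<eta> x * f x) x) \<le> 2 ^ N * M * B"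
      proof (cases "\<bar>x\<bar> > L")
        case True
        then show ?thesis using iter_deriv_eq_0[OF zero] M(1) B0 by simp
      next
        case False
        have "norm (iter_deriv k (\<lambda>x. \<eta> x * f x) x) \<le> 2 ^ k * M * B"
          by (rule norm_iter_deriv_mult_le) (use k False M B f test_fun_smooth[OF \<eta>] in auto)
        also have "\<dots> \<le> 2 ^ N * M * B"
          using k M(1) B0 by (intro mult_right_mono power_increasing) auto
        finally show ?thesis .
      qed
    qed
    then show "norm (pairing T f) \<le> C * (2 ^ N * M) * B" by (simp add: eq f mult_ac)
  qed
qed

lemma pairing_cong:
  assumes S: "compactly_supported_distribution S" and T: "compactly_supported_distribution T"
    and eq: "\<And>f. test_fun f \<Longrightarrow> S f = T f" and f: "smooth_fun f"
  shows "pairing S f = pairing T f"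
proof -
  obtain R where R: "null_outside S R" using compactly_supported_null_outside[OF S] by blast
  obtain R' where R': "null_outside T R'" using compactly_supported_null_outside[OF T] by blast
  obtain \<eta> where \<eta>: "test_fun \<eta>" "\<And>x. \<bar>x\<bar> \<le> max R R' \<Longrightarrow> \<eta> x = 1"
    using cutoff_exists[of "max R R'"] by blast
  have \<eta>f: "test_fun (\<lambda>x. \<eta> x * f x)" by (intro test_fun_mult \<eta> f)
  have "pairing S f = S (\<lambda>x. \<eta> x * f x)" by (rule pairing_eq[OF S R f \<eta>f]) (simp add: \<eta>)
  also have "\<dots> = T (\<lambda>x. \<eta> x * f x)" by (rule eq[OF \<eta>f])
  also have "\<dots> = pairing T f" by (rule pairing_eq[OF T R' f \<eta>f, symmetric]) (simp add: \<eta>)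
  finally show ?thesis .
qed

section \<open>Moments\<close>

abbreviation moment :: "((real \<Rightarrow> complex) \<Rightarrow> complex) \<Rightarrow> nat \<Rightarrow> complex" where
  "moment T m \<equiv> pairing T (\<lambda>x. of_real x ^ m)"

text \<open>Equal moments give equal values on polynomials, and polynomials are dense for the seminorms
  that bound both distributions.\<close>

theorem moments_determine_distribution:
  assumes S: "compactly_supported_distribution S" and T: "compactly_supported_distribution T"
    and moments: "\<And>m. moment S m = moment T m" and f: "test_fun f"
  shows "S f = T f"
proof -
  have poly: "pairing U (\<lambda>x. poly p (of_real x)) = (\<Sum>i\<le>degree p. coeff p i * moment U i)"
    if "compactly_supported_distribution U" for U p
    unfolding poly_altdef using that by (intro pairing_sum smooth_fun_power)
  obtain C N L where C: "C \<ge> 0" and L: "L > 0" and CN: "\<And>f B. \<lbrakk>smooth_fun f;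
      \<And>k x. k \<le> N \<Longrightarrow> \<bar>x\<bar> \<le> L \<Longrightarrow> norm (iter_deriv k f x) \<le> B\<rbrakk> \<Longrightarrow> norm (pairing S f) \<le> C * B"
    using pairing_bound[OF S] by metis
  obtain C' N' L' where C': "C' \<ge> 0" and L': "L' > 0" and CN': "\<And>f B. \<lbrakk>smooth_fun f;
      \<And>k x. k \<le> N' \<Longrightarrow> \<bar>x\<bar> \<le> L' \<Longrightarrow> norm (iter_deriv k f x) \<le> B\<rbrakk> \<Longrightarrow> norm (pairing T f) \<le> C' * B"
    using pairing_bound[OF T] by metis
  have f': "smooth_fun f" by (rule test_fun_smooth[OF f])
  have le: "norm (S f - T f) \<le> (C + C') * e" if "e > 0" for e
  proof -
    obtain p :: "complex poly" where p: "\<And>k x. k \<le> max N N' \<Longrightarrow> \<bar>x\<bar> \<le> max L L' \<Longrightarrow>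
        norm (iter_deriv k (\<lambda>x. f x - poly p (of_real x)) x) \<le> e"
      using smooth_polynomial_approximation[OF f' \<open>e > 0\<close>, of "max L L'" "max N N'"] L
      by (metis less_max_iff_disj)
    define g where "g = (\<lambda>x. f x - poly p (of_real x))"
    have g: "smooth_fun g" unfolding g_def by (intro iter_deriv_minus f' iter_deriv_poly)
    have "S f - T f = pairing S g - pairing T g"
      unfolding g_def
      by (simp add: pairing_linear(3) S T f' iter_deriv_poly pairing_test_fun f poly moments)
    also have "norm \<dots> \<le> C * e + C' * e"
      by (rule order_trans[OF norm_triangle_ineq4 add_mono])
        (use p[folded g_def] in \<open>auto intro!: CN CN' g\<close>)
    finally show ?thesis by (simp add: distrib_right)
  qed
  have "norm (S f - T f) \<le> 0"
  proof (rule field_le_epsilon)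
    fix e :: real assume "e > 0"
    have "norm (S f - T f) \<le> (C + C') * (e / (C + C' + 1))"
      by (rule le) (use \<open>e > 0\<close> C C' in auto)
    also have "\<dots> \<le> 0 + e" using \<open>e > 0\<close> C C' by (simp add: field_simps)
    finally show "norm (S f - T f) \<le> 0 + e" .
  qed
  then show ?thesis by simp
qed

lemma exp_partial_sums_uniform:
  fixes r e :: real
  assumes "e > 0"
  obtains n0 where "\<And>n w. n \<ge> n0 \<Longrightarrow> norm (w::complex) \<le> r \<Longrightarrow>
    norm (exp w - (\<Sum>m<n. w ^ m / fact m)) \<le> e"
proof -
  have "uniform_limit (cball 0 r) (\<lambda>n w. \<Sum>m<n. w ^ m / fact m)
      (\<lambda>w::complex. \<Sum>m. w ^ m / fact m) sequentially"
  proof (rule Weierstrass_m_test)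
    show "norm (w ^ n / fact n) \<le> r ^ n /\<^sub>R fact n" if "w \<in> cball 0 r" for n and w :: complex
      using that by (auto simp: norm_divide norm_power norm_mult norm_inverse divide_inverse mult.commute
          intro!: mult_left_mono power_mono)
  qed (rule summable_exp_generic)
  moreover have "(\<Sum>m. w ^ m / fact m) = exp w" for w :: complex
    by (simp add: exp_def scaleR_conv_of_real divide_inverse mult.commute)
  ultimately have "\<forall>\<^sub>F n in sequentially. \<forall>w\<in>cball 0 r. dist (\<Sum>m<n. w ^ m / fact m) (exp (w::complex)) < e"
    using assms by (auto dest: uniform_limitD)
  then obtain n0 where "\<And>n w. n \<ge> n0 \<Longrightarrow> w \<in> cball 0 r \<Longrightarrow>
      dist (\<Sum>m<n. w ^ m / fact m) (exp (w::complex)) < e"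
    unfolding eventually_sequentially by blast
  then show ?thesis
    by (intro that[of n0]) (force simp: dist_norm norm_minus_commute intro: less_imp_le)
qed

text \<open>The exponential series converges together with all derivatives on bounded sets: the \<open>k\<close>-th
  derivative of the remainder \<open>r n\<close> is \<open>z ^ k\<close> times the earlier remainder \<open>r (n - k)\<close>. Hence
  \<open>pairing T (r n)\<close> tends to \<open>0\<close>.\<close>

lemma fourier_sums_moments:
  assumes T: "compactly_supported_distribution T"
  shows "(\<lambda>m. moment T m / fact m * z ^ m) sums fourier T (\<i> * z)"
proof -
  define r where "r = (\<lambda>n (x::real). exp (z * of_real x) - (\<Sum>m<n. (z * of_real x) ^ m / fact m))"
  \<comment> \<open>the truncated subtraction \<open>n - k\<close> is right since \<open>r 0\<close> is the full exponential, which
    reproduces itself up to the factor \<open>z\<close>\<close>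
  have r: "smooth_fun (r n)" "iter_deriv k (r n) = (\<lambda>x. z ^ k * r (n - k) x)" for n k
  proof -
    have r': "(r n has_vector_derivative z * r (n - 1) x) (at x)" for n x
    proof (cases n)
      case 0
      then show ?thesis
        using smooth_fun_has_vector_derivative[OF iter_deriv_exp(1)[of z], of 0 x]
        by (simp add: iter_deriv_exp(2) r_def)
    next
      case (Suc n)
      have "((\<lambda>w. exp (z * w) - (\<Sum>m<Suc n. (z * w) ^ m / fact m)) has_field_derivative
          z * exp (z * of_real x) - (\<Sum>m<Suc n. of_nat m * (z * of_real x) ^ (m - 1) * z / fact m)) (at (of_real x))"
        by (auto intro!: derivative_eq_intros simp: mult_ac)
      also have "(\<Sum>m<Suc n. of_nat m * (z * of_real x) ^ (m - 1) * z / fact m) =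
          z * (\<Sum>m<n. (z * of_real x) ^ m / fact m)"
        by (subst sum.lessThan_Suc_shift)
          (simp add: sum_distrib_left field_simps del: of_nat_Suc)
      finally show ?thesis
        using has_vector_derivative_real_field unfolding Suc r_def
        by (fastforce simp: right_diff_distrib)
    qed
    have "((\<lambda>x. z ^ k * r (n - k) x) has_vector_derivative z ^ Suc k * r (n - Suc k) x) (at x)" for k x
      using has_vector_derivative_mult_right[OF r'[of "n - k" x], of "z ^ k"] by (simp add: mult_ac)
    from iter_deriv_sequence[of "\<lambda>k x. z ^ k * r (n - k) x" "r n", OF _ this]
    show "smooth_fun (r n)" "iter_deriv k (r n) = (\<lambda>x. z ^ k * r (n - k) x)" by auto
  qed
  have partial: "(\<Sum>m<n. moment T m / fact m * z ^ m) = fourier T (\<i> * z) - pairing T (r n)" for n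
  proof -
    have *: "(\<Sum>m<n. (z * of_real x) ^ m / fact m) = (\<Sum>m<n. (z ^ m / fact m) * of_real x ^ m)" for x
      by (simp add: power_mult_distrib)
    have "pairing T (r n) = pairing T (\<lambda>x. exp (z * of_real x)) - (\<Sum>m<n. (z ^ m / fact m) * moment T m)"
      unfolding r_def *
      by (simp add: pairing_linear(3)[OF T] iter_deriv_exp smooth_fun_sum iter_deriv_scale
          smooth_fun_power pairing_sum[OF T] del: times_divide_eq_left)
    then show ?thesis by (simp add: fourier_def mult.commute flip: mult.assoc)
  qed
  obtain C N L where C: "C \<ge> 0" and CN: "\<And>f B. \<lbrakk>smooth_fun f;
      \<And>k x. k \<le> N \<Longrightarrow> \<bar>x\<bar> \<le> L \<Longrightarrow> norm (iter_deriv k f x) \<le> B\<rbrakk> \<Longrightarrow> norm (pairing T f) \<le> C * B"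
    using pairing_bound[OF T] by metis
  have "(\<lambda>n. pairing T (r n)) \<longlonglongrightarrow> 0"
  proof (rule LIMSEQ_I)
    fix e :: real assume "e > 0"
    define A where "A = (1 + norm z) ^ N"
    define d where "d = e / (C * A + 1)"
    have A: "A > 0" unfolding A_def by (intro zero_less_power) (simp add: add_pos_nonneg)
    have d: "d > 0" using \<open>e > 0\<close> C A by (simp add: d_def add_nonneg_pos)
    obtain n0 where n0: "\<And>n w. n \<ge> n0 \<Longrightarrow> norm (w::complex) \<le> norm z * L \<Longrightarrow>
        norm (exp w - (\<Sum>m<n. w ^ m / fact m)) \<le> d"
      using exp_partial_sums_uniform[OF d] by metis
    have "norm (pairing T (r n)) < e" if n: "n \<ge> n0 + N" for n
    proof -
      have "norm (iter_deriv k (r n) x) \<le> A * d" if "k \<le> N" "\<bar>x\<bar> \<le> L" for k x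
      proof -
        have "norm z ^ k \<le> (1 + norm z) ^ k" by (intro power_mono) auto
        also have "\<dots> \<le> A" unfolding A_def using that by (intro power_increasing) auto
        finally have "norm z ^ k \<le> A" .
        moreover have "norm (r (n - k) x) \<le> d"
          unfolding r_def using n that by (intro n0) (auto simp: norm_mult intro: mult_left_mono)
        ultimately show ?thesis
          unfolding r(2) norm_mult norm_power using A by (intro mult_mono) auto
      qed
      then have "norm (pairing T (r n)) \<le> C * (A * d)" by (intro CN r)
      also have "\<dots> < e"
      proof -
        have "e * (C * A) < e * (C * A + 1)" using \<open>e > 0\<close> by simp
        moreover have "C * A + 1 > 0" using C A by (simp add: add_nonneg_pos)
        ultimately show ?thesis by (simp add: d_def divide_simps mult_ac)
      qed
      finally show ?thesis .
    qed
    then show "\<exists>n0. \<forall>n\<ge>n0. norm (pairing T (r n) - 0) < e" by auto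
  qed
  from tendsto_diff[OF tendsto_const this, of "fourier T (\<i> * z)"]
  show ?thesis unfolding sums_def partial by simp
qed

section \<open>Convolution and dilation\<close>

lemma iter_deriv_translate:
  assumes "smooth_fun f"
  shows "smooth_fun (\<lambda>x. f (x + b))"
    and "iter_deriv n (\<lambda>x. f (x + b)) = (\<lambda>x. iter_deriv n f (x + b))"
  using iter_deriv_affine(1)[OF assms, of 1 b] iter_deriv_affine(2)[OF assms, of n 1 b] by simp_all

lemma test_fun_translate: "test_fun f \<Longrightarrow> test_fun (\<lambda>x. f (x + b))"
  using test_fun_affine[of f 1 b] by simp

text \<open>The second order Taylor estimate for \<open>g\<close> and its derivatives bounds the error of the linear
  approximation, as a test function of \<open>u\<close>, by a multiple of \<open>(z - y)\<^sup>2\<close> in every seminorm.\<close>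

lemma distribution_translate_has_vector_derivative:
  assumes T: "distribution T" and g: "test_fun g"
  shows "((\<lambda>y. T (\<lambda>u. g (u + y))) has_vector_derivative T (\<lambda>u. iter_deriv 1 g (u + y))) (at y)"
proof -
  have g': "smooth_fun g" by (rule test_fun_smooth[OF g])
  obtain L where L: "\<And>x. \<bar>x\<bar> > L \<Longrightarrow> g x = 0" using test_fun_support[OF g] by metis
  obtain C N where C: "C \<ge> 0" and CN: "\<And>f B. \<lbrakk>test_fun f; \<And>x. \<bar>x\<bar> > L + \<bar>y\<bar> + 1 \<Longrightarrow> f x = 0;
      \<And>k x. k \<le> N \<Longrightarrow> norm (iter_deriv k f x) \<le> B\<rbrakk> \<Longrightarrow> norm (T f) \<le> C * B"
    using distribution_bound[OF T] by metis
  obtain M where M: "M \<ge> 0" "\<And>k x. k \<le> N + 2 \<Longrightarrow> norm (iter_deriv k g x) \<le> M"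
    using test_fun_derivs_bounded[OF g] by blast
  let ?F = "\<lambda>y. T (\<lambda>u. g (u + y))" and ?F' = "T (\<lambda>u. iter_deriv 1 g (u + y))"
  \<comment> \<open>the error of the linear approximation is \<open>T\<close> of the test function \<open>r\<close> below\<close>
  have quad: "norm (?F z - ?F y - (z - y) *\<^sub>R ?F') \<le> C * (M * \<bar>z - y\<bar>\<^sup>2)" if z: "\<bar>z - y\<bar> \<le> 1" for z
  proof -
    define r where "r = (\<lambda>u. (g (u + z) - g (u + y)) - of_real (z - y) * iter_deriv 1 g (u + y))"
    note tests = test_fun_translate[OF g] test_fun_translate[OF test_fun_iter_deriv[OF g]]
    have test_r: "test_fun r" unfolding r_def by (intro test_fun_minus test_fun_scale tests)
    have "?F z - ?F y - of_real (z - y) * ?F' = T r"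
      unfolding r_def using tests
      by (simp only: distribution_linear[OF T] test_fun_minus test_fun_scale)
    moreover have "norm (T r) \<le> C * (M * \<bar>z - y\<bar>\<^sup>2)"
    proof (rule CN[OF test_r])
      show "r u = 0" if "\<bar>u\<bar> > L + \<bar>y\<bar> + 1" for u
      proof -
        have "\<bar>u + z\<bar> > L" "\<bar>u + y\<bar> > L" using that z by linarith+
        then show ?thesis by (simp add: r_def L iter_deriv_eq_0[OF L])
      qed
      fix k u assume k: "k \<le> N"
      have "iter_deriv k r u = iter_deriv k g (u + z) - iter_deriv k g (u + y) -
          of_real (z - y) * iter_deriv 1 (iter_deriv k g) (u + y)"
        unfolding r_def
        by (simp add: iter_deriv_minus iter_deriv_scale iter_deriv_translate g' smooth_fun_iter_deriv
            iter_deriv_iter_deriv del: of_real_diff)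
      moreover have "norm (iter_deriv k g (u + z) - iter_deriv k g (u + y) -
          of_real ((u + z) - (u + y)) * iter_deriv 1 (iter_deriv k g) (u + y)) \<le>
          M * \<bar>(u + z) - (u + y)\<bar>\<^sup>2"
        by (rule smooth_fun_taylor2)
          (use k M g' in \<open>auto intro: smooth_fun_iter_deriv simp: iter_deriv_iter_deriv\<close>)
      ultimately show "norm (iter_deriv k r u) \<le> M * \<bar>z - y\<bar>\<^sup>2" by simp
    qed
    ultimately show ?thesis by (simp only: scaleR_conv_of_real)
  qed
  show ?thesis
    unfolding has_vector_derivative_def has_derivative_at_alt
  proof (intro conjI allI impI)
    show "bounded_linear (\<lambda>h. h *\<^sub>R ?F')" by (rule bounded_linear_scaleR_left)
    fix e :: real assume "e > 0"
    have CM: "C * M \<ge> 0" using C M by simp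
    show "\<exists>d>0. \<forall>z. norm (z - y) < d \<longrightarrow> norm (?F z - ?F y - (z - y) *\<^sub>R ?F') \<le> e * norm (z - y)"
    proof (intro exI conjI allI impI)
      show "min 1 (e / (C * M + 1)) > 0" using \<open>e > 0\<close> CM by simp
      fix z assume z: "norm (z - y) < min 1 (e / (C * M + 1))"
      have "norm (?F z - ?F y - (z - y) *\<^sub>R ?F') \<le> C * (M * \<bar>z - y\<bar>\<^sup>2)"
        using z by (intro quad) auto
      also have "\<dots> = (C * M * \<bar>z - y\<bar>) * \<bar>z - y\<bar>" by (simp add: power2_eq_square mult_ac)
      also have "\<dots> \<le> e * \<bar>z - y\<bar>"
      proof (rule mult_right_mono)
        have "C * M * \<bar>z - y\<bar> \<le> (C * M + 1) * \<bar>z - y\<bar>" by (intro mult_right_mono) auto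
        also have "\<dots> \<le> e" using z CM by (simp add: field_simps)
        finally show "C * M * \<bar>z - y\<bar> \<le> e" .
      qed simp
      finally show "norm (?F z - ?F y - (z - y) *\<^sub>R ?F') \<le> e * norm (z - y)" by simp
    qed
  qed
qed

lemma iter_deriv_distribution_translate:
  assumes T: "distribution T" and g: "test_fun g"
  shows "smooth_fun (\<lambda>y. T (\<lambda>u. g (u + y)))"
    and "iter_deriv n (\<lambda>y. T (\<lambda>u. g (u + y))) = (\<lambda>y. T (\<lambda>u. iter_deriv n g (u + y)))"
proof -
  have "((\<lambda>y. T (\<lambda>u. iter_deriv n g (u + y))) has_vector_derivative
      T (\<lambda>u. iter_deriv (Suc n) g (u + y))) (at y)" for n y
    using distribution_translate_has_vector_derivative[OF T test_fun_iter_deriv[OF g], of n y]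
    by (simp add: iter_deriv_iter_deriv)
  from iter_deriv_sequence[of "\<lambda>n y. T (\<lambda>u. iter_deriv n g (u + y))" "\<lambda>y. T (\<lambda>u. g (u + y))", OF _ this]
  show "smooth_fun (\<lambda>y. T (\<lambda>u. g (u + y)))"
    and "iter_deriv n (\<lambda>y. T (\<lambda>u. g (u + y))) = (\<lambda>y. T (\<lambda>u. iter_deriv n g (u + y)))"
    by auto
qed

definition convolution ::
    "((real \<Rightarrow> complex) \<Rightarrow> complex) \<Rightarrow> ((real \<Rightarrow> complex) \<Rightarrow> complex) \<Rightarrow> (real \<Rightarrow> complex) \<Rightarrow> complex" where
  "convolution S T g = T (\<lambda>y. S (\<lambda>u. g (u + y)))"

lemma translate_null_outside:
  assumes R: "null_outside T R" and g: "test_fun g" and L: "\<And>x. \<bar>x\<bar> > L \<Longrightarrow> g x = 0"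
    and y: "\<bar>y\<bar> > L + R"
  shows "T (\<lambda>u. g (u + y)) = 0"
proof -
  have "g (u + y) = 0" if "\<bar>u\<bar> < R" for u
    by (rule L) (use that y in linarith)
  then show ?thesis using R test_fun_translate[OF g] unfolding null_outside_def by blast
qed

lemma test_fun_distribution_translate:
  assumes T: "distribution T" and R: "null_outside T R" and g: "test_fun g"
  shows "test_fun (\<lambda>y. T (\<lambda>u. g (u + y)))"
proof -
  obtain L where "\<And>x. \<bar>x\<bar> > L \<Longrightarrow> g x = 0" using test_fun_support[OF g] by metis
  from translate_null_outside[OF R g this]
  have "\<forall>y. \<bar>y\<bar> > L + R \<longrightarrow> T (\<lambda>u. g (u + y)) = 0" by blast
  with iter_deriv_distribution_translate(1)[OF T g] show ?thesis unfolding test_fun_iff by blast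
qed

lemma convolution_null_outside:
  assumes R: "null_outside S R" and R': "null_outside T R'" and S: "distribution S"
  shows "null_outside (convolution S T) (R + R')"
  unfolding null_outside_def
proof (intro allI impI)
  fix g assume g: "test_fun g" and zero: "\<forall>x. \<bar>x\<bar> < R + R' \<longrightarrow> g x = 0"
  have "S (\<lambda>u. g (u + y)) = 0" if y: "\<bar>y\<bar> < R'" for y
  proof -
    have "g (u + y) = 0" if "\<bar>u\<bar> < R" for u
    proof -
      have "\<bar>u + y\<bar> < R + R'" using that y by linarith
      then show ?thesis using zero by blast
    qed
    then show ?thesis using R test_fun_translate[OF g] unfolding null_outside_def by blast
  qed
  then show "convolution S T g = 0"
    using R' test_fun_distribution_translate[OF S R g] unfolding null_outside_def convolution_def by blast
qed

text \<open>The derivatives of \<open>y \<mapsto> S (\<lambda>u. g (u + y))\<close> are the same functions for the derivatives of \<open>g\<close>, so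
  that the orders of \<open>S\<close> and \<open>T\<close> add up.\<close>

lemma distribution_convolution:
  assumes S: "distribution S" and R: "null_outside S R" and T: "distribution T"
  shows "distribution (convolution S T)"
proof (rule distributionI)
  note tr = test_fun_translate
  note testF = test_fun_distribution_translate[OF S R]
  fix f g and c :: complex assume f: "test_fun f"
  show "convolution S T (\<lambda>x. c * f x) = c * convolution S T f"
    unfolding convolution_def distribution_linear(2)[OF S tr[OF f]]
    by (rule distribution_linear(2)[OF T testF[OF f]])
  assume g: "test_fun g"
  show "convolution S T (\<lambda>x. f x + g x) = convolution S T f + convolution S T g"
    unfolding convolution_def distribution_linear(1)[OF S tr[OF f] tr[OF g]]
    by (rule distribution_linear(1)[OF T testF[OF f] testF[OF g]])
next
  fix L :: real
  obtain C N where C: "C \<ge> 0" and CN: "\<And>f B. \<lbrakk>test_fun f; \<And>x. \<bar>x\<bar> > L + R \<Longrightarrow> f x = 0;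
      \<And>k x. k \<le> N \<Longrightarrow> norm (iter_deriv k f x) \<le> B\<rbrakk> \<Longrightarrow> norm (T f) \<le> C * B"
    using distribution_bound[OF T] by metis
  obtain C' N' where C': "C' \<ge> 0" and CN': "\<And>f B. \<lbrakk>test_fun f; \<And>x. \<bar>x\<bar> > L + (L + R) \<Longrightarrow> f x = 0;
      \<And>k x. k \<le> N' \<Longrightarrow> norm (iter_deriv k f x) \<le> B\<rbrakk> \<Longrightarrow> norm (S f) \<le> C' * B"
    using distribution_bound[OF S] by metis
  have bound: "norm (convolution S T g) \<le> C * C' * B"
    if g: "test_fun g" and L: "\<And>x. \<bar>x\<bar> > L \<Longrightarrow> g x = 0"
      and B: "\<And>k x. k \<le> N + N' \<Longrightarrow> norm (iter_deriv k g x) \<le> B" for g B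
  proof -
    have B0: "B \<ge> 0" using order_trans[OF norm_ge_zero B[of 0 0]] by simp
    have "norm (convolution S T g) \<le> C * (C' * B)"
      unfolding convolution_def
    proof (rule CN[OF test_fun_distribution_translate[OF S R g] translate_null_outside[OF R g L]])
      fix k y assume k: "k \<le> N"
      show "norm (iter_deriv k (\<lambda>y. S (\<lambda>u. g (u + y))) y) \<le> C' * B"
      proof (cases "\<bar>y\<bar> > L + R")
        case True
        then show ?thesis
          using iter_deriv_eq_0[OF translate_null_outside[OF R g L]] C' B0 by simp
      next
        case False
        have "norm (S (\<lambda>u. iter_deriv k g (u + y))) \<le> C' * B"
        proof (rule CN'[OF test_fun_translate[OF test_fun_iter_deriv[OF g]]])
          show "iter_deriv k g (u + y) = 0" if "\<bar>u\<bar> > L + (L + R)" for u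
          proof -
            have "\<bar>u + y\<bar> > L" using that False by linarith
            then show ?thesis using iter_deriv_eq_0[of L g] L by blast
          qed
          fix j u assume "j \<le> N'"
          then show "norm (iter_deriv j (\<lambda>u. iter_deriv k g (u + y)) u) \<le> B"
            using k B by (simp add: iter_deriv_translate smooth_fun_iter_deriv test_fun_smooth g
                iter_deriv_iter_deriv)
        qed
        then show ?thesis by (simp add: iter_deriv_distribution_translate(2)[OF S g])
      qed
    qed
    then show ?thesis by (simp add: mult.assoc)
  qed
  show "\<exists>C N. \<forall>f B. test_fun f \<longrightarrow> (\<forall>x. \<bar>x\<bar> > L \<longrightarrow> f x = 0) \<longrightarrow>
      (\<forall>k\<le>N. \<forall>x. norm (iter_deriv k f x) \<le> B) \<longrightarrow> norm (convolution S T f) \<le> C * B"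
    by (intro exI[of _ "C * C'"] exI[of _ "N + N'"] allI impI, rule bound) simp_all
qed

lemma compactly_supported_convolution:
  assumes S: "compactly_supported_distribution S" and T: "compactly_supported_distribution T"
  shows "compactly_supported_distribution (convolution S T)"
proof -
  have dist: "distribution S" "distribution T"
    using S T by (simp_all add: compactly_supported_distribution_def)
  obtain R where R: "null_outside S R" using compactly_supported_null_outside[OF S] by blast
  obtain R' where R': "null_outside T R'" using compactly_supported_null_outside[OF T] by blast
  show ?thesis
    by (rule null_outside_compactly_supported[OF distribution_convolution[OF dist(1) R dist(2)]
          convolution_null_outside[OF R R' dist(1)]])
qed

text \<open>The binomial expansion of \<open>(u + y) ^ m\<close>; a cutoff makes it a test function without changing it
  where the supports of \<open>S\<close> and \<open>T\<close> can see it.\<close>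

lemma moment_convolution:
  assumes S: "compactly_supported_distribution S" and T: "compactly_supported_distribution T"
  shows "moment (convolution S T) m = (\<Sum>k\<le>m. of_nat (m choose k) * moment S k * moment T (m - k))"
proof -
  have dist: "distribution S" using S by (simp add: compactly_supported_distribution_def)
  obtain R where R: "null_outside S R" using compactly_supported_null_outside[OF S] by blast
  obtain R' where R': "null_outside T R'" using compactly_supported_null_outside[OF T] by blast
  obtain \<eta> where \<eta>: "test_fun \<eta>" "\<And>x. \<bar>x\<bar> \<le> R + R' \<Longrightarrow> \<eta> x = 1" using cutoff_exists[of "R + R'"] by blast
  define g where "g = (\<lambda>x. \<eta> x * of_real x ^ m)"
  have g: "test_fun g" unfolding g_def by (intro test_fun_mult \<eta> smooth_fun_power)
  have inner: "S (\<lambda>u. g (u + y)) =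
      (\<Sum>k\<le>m. of_nat (m choose k) * moment S k * of_real y ^ (m - k))" if y: "\<bar>y\<bar> < R'" for y
  proof -
    let ?q = "\<lambda>u. \<Sum>k\<le>m. (of_nat (m choose k) * of_real y ^ (m - k)) * complex_of_real u ^ k"
    have "S (\<lambda>u. g (u + y)) = pairing S ?q"
    proof (rule pairing_eq[OF S R _ test_fun_translate[OF g], symmetric])
      show "smooth_fun ?q" by (intro smooth_fun_sum iter_deriv_scale smooth_fun_power)
      fix u assume "\<bar>u\<bar> < R"
      then have "\<eta> (u + y) = 1" using y by (intro \<eta>) linarith
      then show "g (u + y) = ?q u" by (simp add: g_def binomial_ring mult_ac)
    qed
    also have "\<dots> = (\<Sum>k\<le>m. (of_nat (m choose k) * of_real y ^ (m - k)) * moment S k)"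
      by (rule pairing_sum[OF S smooth_fun_power])
    finally show ?thesis by (simp add: mult_ac)
  qed
  have "moment (convolution S T) m = convolution S T g"
    by (rule pairing_eq[OF compactly_supported_convolution[OF S T] convolution_null_outside[OF R R' dist]
          smooth_fun_power g]) (simp add: g_def \<eta>)
  also have "\<dots> = pairing T (\<lambda>y. \<Sum>k\<le>m. (of_nat (m choose k) * moment S k) * of_real y ^ (m - k))"
    unfolding convolution_def
    by (rule pairing_eq[OF T R' _ test_fun_distribution_translate[OF dist R g] inner, symmetric])
      (intro smooth_fun_sum iter_deriv_scale smooth_fun_power)
  also have "\<dots> = (\<Sum>k\<le>m. of_nat (m choose k) * moment S k * moment T (m - k))"
    by (intro pairing_sum T smooth_fun_power)
  finally show ?thesis .
qed

definition dilation :: "real \<Rightarrow> ((real \<Rightarrow> complex) \<Rightarrow> complex) \<Rightarrow> (real \<Rightarrow> complex) \<Rightarrow> complex" where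
  "dilation a T f = T (\<lambda>x. f (a * x))"

lemma test_fun_dilate: "test_fun f \<Longrightarrow> a \<noteq> 0 \<Longrightarrow> test_fun (\<lambda>x. f (a * x))"
  using test_fun_affine[of f a 0] by simp

lemma dilation_null_outside:
  assumes "null_outside T R" and "a > 0"
  shows "null_outside (dilation a T) (a * R)"
  unfolding null_outside_def
proof (intro allI impI)
  fix f assume f: "test_fun f" and zero: "\<forall>x. \<bar>x\<bar> < a * R \<longrightarrow> f x = 0"
  have "f (a * x) = 0" if "\<bar>x\<bar> < R" for x
  proof -
    have "\<bar>a * x\<bar> < a * R" using that assms(2) by (simp add: abs_mult)
    then show ?thesis using zero by blast
  qed
  then show "dilation a T f = 0"
    using assms test_fun_dilate[OF f, of a] unfolding null_outside_def dilation_def by auto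
qed

lemma compactly_supported_dilation:
  assumes T: "compactly_supported_distribution T" and a: "a > 0"
  shows "compactly_supported_distribution (dilation a T)"
proof -
  have dist: "distribution T" using T by (simp add: compactly_supported_distribution_def)
  obtain R where R: "null_outside T R" using compactly_supported_null_outside[OF T] by blast
  have "distribution (dilation a T)"
  proof (rule distributionI)
    fix f g and c :: complex assume f: "test_fun f"
    have f': "test_fun (\<lambda>x. f (a * x))" using f a by (simp add: test_fun_dilate)
    show "dilation a T (\<lambda>x. c * f x) = c * dilation a T f"
      unfolding dilation_def by (rule distribution_linear(2)[OF dist f'])
    assume "test_fun g"
    then have "test_fun (\<lambda>x. g (a * x))" using a by (simp add: test_fun_dilate)
    then show "dilation a T (\<lambda>x. f x + g x) = dilation a T f + dilation a T g"
      unfolding dilation_def by (rule distribution_linear(1)[OF dist f'])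
  next
    fix L :: real
    obtain C N where C: "C \<ge> 0" and CN: "\<And>f B. \<lbrakk>test_fun f; \<And>x. \<bar>x\<bar> > L / a \<Longrightarrow> f x = 0;
        \<And>k x. k \<le> N \<Longrightarrow> norm (iter_deriv k f x) \<le> B\<rbrakk> \<Longrightarrow> norm (T f) \<le> C * B"
      using distribution_bound[OF dist] by metis
    have bound: "norm (dilation a T f) \<le> C * (1 + a) ^ N * B"
      if f: "test_fun f" and L: "\<And>x. \<bar>x\<bar> > L \<Longrightarrow> f x = 0"
        and B: "\<And>k x. k \<le> N \<Longrightarrow> norm (iter_deriv k f x) \<le> B" for f B
    proof -
      have "norm (dilation a T f) \<le> C * ((1 + a) ^ N * B)"
        unfolding dilation_def
      proof (rule CN)
        show "test_fun (\<lambda>x. f (a * x))" using f a by (simp add: test_fun_dilate)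
        show "f (a * x) = 0" if "\<bar>x\<bar> > L / a" for x
          by (rule L) (use that a in \<open>simp add: abs_mult field_simps\<close>)
        fix k x assume k: "k \<le> N"
        have "norm (iter_deriv k (\<lambda>x. f (a * x)) x) = a ^ k * norm (iter_deriv k f (a * x))"
          using iter_deriv_affine(2)[OF test_fun_smooth[OF f], of k a 0] a
          by (simp add: norm_mult norm_power)
        also have "\<dots> \<le> (1 + a) ^ N * B"
        proof (rule mult_mono)
          have "a ^ k \<le> (1 + a) ^ k" using a by (intro power_mono) auto
          also have "\<dots> \<le> (1 + a) ^ N" using a k by (intro power_increasing) auto
          finally show "a ^ k \<le> (1 + a) ^ N" .
        qed (use a B k in auto)
        finally show "norm (iter_deriv k (\<lambda>x. f (a * x)) x) \<le> (1 + a) ^ N * B" .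
      qed
      then show ?thesis by (simp add: mult.assoc)
    qed
    show "\<exists>C N. \<forall>f B. test_fun f \<longrightarrow> (\<forall>x. \<bar>x\<bar> > L \<longrightarrow> f x = 0) \<longrightarrow>
        (\<forall>k\<le>N. \<forall>x. norm (iter_deriv k f x) \<le> B) \<longrightarrow> norm (dilation a T f) \<le> C * B"
      by (intro exI[of _ "C * (1 + a) ^ N"] exI[of _ N] allI impI, rule bound) simp_all
  qed
  then show ?thesis
    by (rule null_outside_compactly_supported[OF _ dilation_null_outside[OF R a]])
qed

lemma moment_dilation:
  assumes T: "compactly_supported_distribution T" and a: "a > 0"
  shows "moment (dilation a T) m = of_real a ^ m * moment T m"
proof -
  obtain R where R: "null_outside T R" using compactly_supported_null_outside[OF T] by blast
  obtain \<eta> where \<eta>: "test_fun \<eta>" "\<And>x. \<bar>x\<bar> \<le> a * R \<Longrightarrow> \<eta> x = 1" using cutoff_exists[of "a * R"] by blast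
  define g where "g = (\<lambda>x. \<eta> x * of_real x ^ m)"
  have g: "test_fun g" unfolding g_def by (intro test_fun_mult \<eta> smooth_fun_power)
  have ga: "test_fun (\<lambda>x. g (a * x))" using g a by (simp add: test_fun_dilate)
  have "moment (dilation a T) m = T (\<lambda>x. g (a * x))"
    unfolding dilation_def[symmetric]
    by (rule pairing_eq[OF compactly_supported_dilation[OF T a] dilation_null_outside[OF R a]
          smooth_fun_power g]) (simp add: g_def \<eta>)
  also have "\<dots> = pairing T (\<lambda>x. of_real a ^ m * of_real x ^ m)"
  proof (rule pairing_eq[OF T R _ ga, symmetric])
    show "smooth_fun (\<lambda>x. of_real a ^ m * of_real x ^ m)" by (intro iter_deriv_scale smooth_fun_power)
    fix x assume "\<bar>x\<bar> < R"
    then have "\<eta> (a * x) = 1" using a by (intro \<eta>) (simp add: abs_mult)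
    then show "g (a * x) = of_real a ^ m * of_real x ^ m" by (simp add: g_def power_mult_distrib)
  qed
  also have "\<dots> = of_real a ^ m * moment T m"
    by (rule pairing_linear(2)[OF T smooth_fun_power])
  finally show ?thesis .
qed

section \<open>Generating functions of moments and the refinement equation\<close>

definition moment_fps :: "((real \<Rightarrow> complex) \<Rightarrow> complex) \<Rightarrow> complex fps" where
  "moment_fps T = Abs_fps (\<lambda>m. moment T m / fact m)"

lemma fourier_has_fps_expansion:
  assumes "compactly_supported_distribution T"
  shows "(\<lambda>z. fourier T (\<i> * z)) has_fps_expansion moment_fps T"
  using fourier_sums_moments[OF assms]
  by (intro has_fps_expansionI always_eventually) (simp add: moment_fps_def)

lemma moment_fps_convolution:
  assumes "compactly_supported_distribution S" "compactly_supported_distribution T"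
  shows "moment_fps (convolution S T) = moment_fps S * moment_fps T"
proof (rule fps_ext)
  fix m
  have "moment (convolution S T) m / fact m =
      (\<Sum>k\<le>m. of_nat (m choose k) * moment S k * moment T (m - k) / fact m)"
    by (simp add: moment_convolution[OF assms] sum_divide_distrib)
  also have "\<dots> = (\<Sum>k\<le>m. (moment S k / fact k) * (moment T (m - k) / fact (m - k)))"
    by (intro sum.cong refl) (simp add: binomial_fact)
  finally show "fps_nth (moment_fps (convolution S T)) m = fps_nth (moment_fps S * moment_fps T) m"
    by (simp add: moment_fps_def fps_mult_nth atLeast0AtMost)
qed

lemma moment_fps_dilation:
  assumes "compactly_supported_distribution T" "a > 0"
  shows "moment_fps (dilation a T) = moment_fps T oo (fps_const (of_real a) * fps_X)"
  by (simp add: fps_eq_iff moment_fps_def moment_dilation[OF assms])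

text \<open>The refinement equation says that \<open>\<phi>\<close> equals the distribution \<open>S\<close> below on test functions, and
  equality of compactly supported distributions is equality of their moments.\<close>

lemma scaling_with_mask_iff_moment_fps:
  assumes \<alpha>: "\<alpha> > 0" and \<psi>: "compactly_supported_distribution \<psi>"
    and \<phi>: "compactly_supported_distribution \<phi>"
  shows "scaling_with_mask \<alpha> \<phi> \<psi> \<longleftrightarrow>
    moment_fps \<phi> = (moment_fps \<phi> * moment_fps \<psi>) oo (fps_const (of_real (1 / \<alpha>)) * fps_X)"
proof -
  define S where "S = dilation (1 / \<alpha>) (convolution \<phi> \<psi>)"
  note conv = compactly_supported_convolution[OF \<phi> \<psi>]
  have S: "compactly_supported_distribution S"
    unfolding S_def using \<alpha> by (intro compactly_supported_dilation conv) auto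
  have "moment_fps S = (moment_fps \<phi> * moment_fps \<psi>) oo (fps_const (of_real (1 / \<alpha>)) * fps_X)"
    using \<alpha> unfolding S_def by (subst moment_fps_dilation[OF conv]) (auto simp: moment_fps_convolution \<phi> \<psi>)
  moreover have "scaling_with_mask \<alpha> \<phi> \<psi> \<longleftrightarrow> (\<forall>f. test_fun f \<longrightarrow> \<phi> f = S f)"
    by (simp add: scaling_with_mask_def S_def dilation_def convolution_def dilate_shift_def)
  moreover have "moment_fps \<phi> = moment_fps S \<longleftrightarrow> (\<forall>m. moment \<phi> m = moment S m)"
    by (simp add: moment_fps_def fps_eq_iff)
  moreover have "(\<forall>f. test_fun f \<longrightarrow> \<phi> f = S f) \<longleftrightarrow> (\<forall>m. moment \<phi> m = moment S m)"
    using moments_determine_distribution[OF \<phi> S] pairing_cong[OF \<phi> S _ smooth_fun_power] by blast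
  ultimately show ?thesis by simp
qed

text \<open>Both sides are expansions at \<open>0\<close> of the same function \<open>exp (x z) / fourier T (\<i> z)\<close>.\<close>

lemma generated_by_fps:
  assumes T: "compactly_supported_distribution T" and nz: "fourier T 0 \<noteq> 0" and P: "generated_by P T"
  shows "Abs_fps (\<lambda>m. poly (P m) (of_real x) / fact m) = fps_exp (of_real x) * inverse (moment_fps T)"
proof -
  let ?f = "\<lambda>z. exp (of_real x * z) * inverse (fourier T (\<i> * z))"
  have "?f has_fps_expansion Abs_fps (\<lambda>m. poly (P m) (of_real x) / fact m)"
    using P by (intro has_fps_expansionI) (auto simp: generated_by_def divide_inverse mult_ac)
  moreover have "?f has_fps_expansion fps_exp (of_real x) * inverse (moment_fps T)"
  proof (intro has_fps_expansion_mult has_fps_expansion_inverse has_fps_expansion_exp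
      fourier_has_fps_expansion T)
    show "fps_nth (moment_fps T) 0 \<noteq> 0"
      using nz by (simp add: moment_fps_def fourier_def)
  qed
  ultimately show ?thesis
    by (intro fps_ext) (metis fps_nth_fps_expansion)
qed

theorem theorem2p2:
  fixes \<alpha> :: real
    and \<psi> \<phi> :: "(real \<Rightarrow> complex) \<Rightarrow> complex"
    and P Q :: "nat \<Rightarrow> complex poly"
  assumes "\<alpha> > 1"
    and "compactly_supported_distribution \<psi>"
    and "compactly_supported_distribution \<phi>"
    and "fourier \<psi> 0 \<noteq> 0"
    and "fourier \<phi> 0 \<noteq> 0"
    and "appell_sequence P" and "generated_by P \<psi>"
    and "appell_sequence Q" and "generated_by Q \<phi>"
  shows "scaling_with_mask \<alpha> \<phi> \<psi> \<longleftrightarrow>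
    (\<forall>m. \<forall>x::real.
       (\<Sum>k=0..m. of_real (\<alpha> powi (- int m)) * of_nat (m choose k)
          * poly (P k) (of_real (\<alpha> * x)) * poly (Q (m - k)) (of_real (\<alpha> * x)))
       = poly (Q m) (of_real (2 * x)))"
proof -
  define A where "A = moment_fps \<psi>"
  define B where "B = moment_fps \<phi>"
  define X :: "complex fps" where "X = fps_const (of_real (1 / \<alpha>)) * fps_X"
  define p where "p x = Abs_fps (\<lambda>m. poly (P m) (complex_of_real x) / fact m)" for x
  define q where "q x = Abs_fps (\<lambda>m. poly (Q m) (complex_of_real x) / fact m)" for x
  have p: "p x = fps_exp (of_real x) * inverse A" and q: "q x = fps_exp (of_real x) * inverse B" for x
    unfolding p_def q_def A_def B_def by (rule generated_by_fps; fact)+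
  have A0: "fps_nth A 0 \<noteq> 0" and B0: "fps_nth B 0 \<noteq> 0"
    using assms(4,5) by (simp_all add: A_def B_def moment_fps_def fourier_def)
  have X0: "fps_nth X 0 = 0" by (simp add: X_def)
  have exp_X: "fps_exp (of_real (\<alpha> * x)) oo X = fps_exp (of_real x)" for x
    using assms(1) by (simp add: X_def fps_eq_iff power_mult_distrib power_divide)
  have "(\<forall>m. \<forall>x::real.
       (\<Sum>k=0..m. of_real (\<alpha> powi (- int m)) * of_nat (m choose k)
          * poly (P k) (of_real (\<alpha> * x)) * poly (Q (m - k)) (of_real (\<alpha> * x)))
       = poly (Q m) (of_real (2 * x))) \<longleftrightarrow>
      (\<forall>m x. fps_nth ((p (\<alpha> * x) * q (\<alpha> * x)) oo X) m = fps_nth (q (2 * x)) m)"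
  proof (intro all_cong1)
    fix m and x :: real
    have "(\<Sum>k=0..m. of_real (\<alpha> powi (- int m)) * of_nat (m choose k)
          * poly (P k) (of_real (\<alpha> * x)) * poly (Q (m - k)) (of_real (\<alpha> * x))) =
        fact m * fps_nth ((p (\<alpha> * x) * q (\<alpha> * x)) oo X) m"
      unfolding X_def fps_nth_compose_linear fps_mult_nth sum_distrib_left
    proof (intro sum.cong refl)
      fix k assume "k \<in> {0..m}"
      then show "of_real (\<alpha> powi (- int m)) * of_nat (m choose k)
          * poly (P k) (of_real (\<alpha> * x)) * poly (Q (m - k)) (of_real (\<alpha> * x)) =
        fact m * (of_real (1 / \<alpha>) ^ m * (fps_nth (p (\<alpha> * x)) k * fps_nth (q (\<alpha> * x)) (m - k)))"
        by (simp add: p_def q_def binomial_fact power_int_minus power_divide divide_inverse mult_ac power_inverse)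
    qed
    then show "((\<Sum>k=0..m. of_real (\<alpha> powi (- int m)) * of_nat (m choose k)
          * poly (P k) (of_real (\<alpha> * x)) * poly (Q (m - k)) (of_real (\<alpha> * x)))
       = poly (Q m) (of_real (2 * x))) \<longleftrightarrow>
      (fps_nth ((p (\<alpha> * x) * q (\<alpha> * x)) oo X) m = fps_nth (q (2 * x)) m)"
      by (simp add: q_def field_simps)
  qed
  also have "\<dots> \<longleftrightarrow> (\<forall>x. (p (\<alpha> * x) * q (\<alpha> * x)) oo X = q (2 * x))"
    by (auto simp: fps_eq_iff)
  also have "\<dots> \<longleftrightarrow> (\<forall>x::real. fps_exp (of_real (2 * x)) * inverse ((B * A) oo X) =
      fps_exp (of_real (2 * x)) * inverse B)"
  proof (intro all_cong1)
    fix x :: real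
    have "(p (\<alpha> * x) * q (\<alpha> * x)) oo X =
        (fps_exp (of_real x) * fps_exp (of_real x)) * ((inverse A oo X) * (inverse B oo X))"
      unfolding p q fps_compose_mult_distrib[OF X0] exp_X by (simp add: mult_ac)
    also have "fps_exp (complex_of_real x) * fps_exp (of_real x) = fps_exp (of_real (2 * x))"
      by (simp flip: fps_exp_add_mult)
    also have "(inverse A oo X) * (inverse B oo X) = inverse ((B * A) oo X)"
      unfolding fps_compose_mult_distrib[OF X0] fps_inverse_compose[OF X0 A0] fps_inverse_compose[OF X0 B0]
      by (simp add: fps_inverse_mult mult.commute)
    finally show "((p (\<alpha> * x) * q (\<alpha> * x)) oo X = q (2 * x)) \<longleftrightarrow>
        (fps_exp (of_real (2 * x)) * inverse ((B * A) oo X) = fps_exp (of_real (2 * x)) * inverse B)"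
      by (simp add: q)
  qed
  also have "\<dots> \<longleftrightarrow> inverse ((B * A) oo X) = inverse B"
    by simp
  also have "\<dots> \<longleftrightarrow> (B * A) oo X = B"
  proof -
    have "fps_nth ((B * A) oo X) 0 \<noteq> 0" using A0 B0 by simp
    then show ?thesis using B0 fps_inverse_idempotent by metis
  qed
  also have "\<dots> \<longleftrightarrow> scaling_with_mask \<alpha> \<phi> \<psi>"
    using assms(1) scaling_with_mask_iff_moment_fps[of \<alpha> \<psi> \<phi>, OF _ assms(2,3)]
    unfolding A_def B_def X_def by auto
  finally show ?thesis by blast
qed

end
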